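(* Let $Q=\mathbb Z^{\widehat I}/J$, where $\mathbb Z^{\widehat I}$ is the free abelian group on $\widehat I$ and $J$ is the subgroup generated by the elements $$(i,n)-\sum_{j}(j,n+1)+(i,n+2),\qquad (i,n)\in\widehat I,$$ the sum being over all vertices $j\in I$ connected to $i$ in $I$. Then: (1) The identification $\Phi\colon R\to\widehat I$ descends to an isomorphism of lattices $Q(R)\to Q$ (i.e. there is an isomorphism of abelian groups $Q(R)\to Q$ sending each $\alpha\in R$ to the class of $\Phi(\alpha)$), where $Q(R)$ is the root lattice of $R$. (2) For any height function $\eta$, the classes of the elements $(i,\eta(i))\in\widehat I$, $i\in I$, form a basis of $Q$.
   Context: $R\subset E$ is a reduced, irreducible, simply-laced root system (type $A,D,E$) of rank $r$ in a Euclidean space $E$ with $W$-invariant inner product $(\cdot,\cdot)$ normalized so that $(\alpha,\alpha)=2$ for $\alpha\in R$; $W$ is its Weyl group. A simple root system $\Pi\subset R$ is a base of $R$. There is a fixed index set $I$ and, for each simple root system $\Pi$, a bijection $I\to\Pi$, $i\mapsto\alpha_i^\Pi$, such that $w(\alpha_i^\Pi)=\alpha_i^{w(\Pi)}$ for all $w\in W$. For $i\ne j$ put $n_{ij}=-(\alpha_i^\Pi,\alpha_j^\Pi)\in\{0,1\}$ (independent of $\Pi$); $I$ also denotes the Dynkin diagram, the graph with vertex set $I$ and $n_{ij}$ edges between $i$ and $j$. Let $s_i^\Pi$ be the reflection in $\alpha_i^\Pi$. A Coxeter element is a product, in some order, of all the simple reflections of some simple root system, each taken once. A Coxeter element $C$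 is fixed; $h$ is its order (Coxeter number). $\Pi$ is compatible with $C$ if $C=s^\Pi_{i_1}\cdots s^\Pi_{i_r}$ for some enumeration $i_1,\dots,i_r$ of $I$. For compatible $\Pi$, the orientation $\Omega_\Pi$ of $I$ is: for $n_{ij}=1$, $i\to j$ if $s_i^\Pi$ precedes $s_j^\Pi$ in such an expression for $C$ (independent of the expression). Write $i\leqslant j$ if there is an oriented path (possibly of length $0$) from $i$ to $j$ in $\Omega_\Pi$, and set $\beta_i^\Pi=\sum_{j\leqslant i}\alpha_j^\Pi$. The $C$-orbit of $\beta_i^\Pi$ does not depend on the choice of $\Pi$ compatible with $C$. Fix $p\colon I\to\mathbb Z_2$ with $p(i)=p(j)+1$ whenever $i,j$ are connected by an edge, and let $\widehat I=\{(i,n)\in I\times\mathbb Z_{2h}\mid p(i)+n\equiv 0 \bmod 2\}$, with $\tau(i,n)=(i,n+2)$. Fix $i_0\in I$ and a bijection $\Phi_0$ from the $C$-orbit of $\beta_{i_0}^\Pi$ onto $\{(i_0,n)\in\widehat I\}$ with $\Phi_0(C\beta)=\tau\Phi_0(\beta)$ (independent of $\Pi$). $\Phi\colon R\to\widehat I$ is the unique bijection such that, for any $\Pi$ compatible with $C$: $\Phi(C\beta)=\tau\Phi(\beta)$ for all $\beta\in R$; $\Phi(\beta_i^\Pi)\in\{i\}\times\mathbb Z_{2h}$ for all $i\in I$; if $i\to j$ in $\Omega_\Pi$ and $\Phi(\beta_i^\Pi)=(i,n)$ then $\Phi(\beta_j^\Pi)=(j,n+1)$; and $\Phi=\Phi_0$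 on the $C$-orbit of $\beta_{i_0}^\Pi$. ($\Phi$ exists and does not depend on $\Pi$.) A height function is a function $\eta\colon I\to\mathbb Z_{2h}$ such that $\eta(j)=\eta(i)\pm1$ whenever $i,j$ are connected by an edge in $I$, and $\eta(i)\equiv p(i)\bmod 2$ for all $i$. *)

theory Defs
  imports
    "HOL-Analysis.Analysis"
    "HOL-Algebra.Free_Abelian_Groups"
    "HOL-Algebra.Generated_Groups"
    "HOL-Number_Theory.Cong"
begin

section \<open>Root systems\<close>

definition reflection :: "'a::real_inner \<Rightarrow> 'a \<Rightarrow> 'a" where
  "reflection a x = x - (2 * (x \<bullet> a) / (a \<bullet> a)) *\<^sub>R a"

definition root_system :: "'a::euclidean_space set \<Rightarrow> bool" where
  "root_system R \<longleftrightarrow> finite R \<and> 0 \<notin> R \<and> span R = UNIV \<and>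
     (\<forall>a\<in>R. reflection a ` R = R) \<and>
     (\<forall>a\<in>R. \<forall>b\<in>R. 2 * (b \<bullet> a) / (a \<bullet> a) \<in> \<int>)"

definition reduced_roots :: "'a::euclidean_space set \<Rightarrow> bool" where
  "reduced_roots R \<longleftrightarrow> (\<forall>a\<in>R. \<forall>c. c *\<^sub>R a \<in> R \<longrightarrow> c = 1 \<or> c = -1)"

definition irreducible_roots :: "'a::euclidean_space set \<Rightarrow> bool" where
  "irreducible_roots R \<longleftrightarrow> R \<noteq> {} \<and>
     \<not> (\<exists>A B. A \<noteq> {} \<and> B \<noteq> {} \<and> A \<union> B = R \<and> A \<inter> B = {} \<and> (\<forall>a\<in>A. \<forall>b\<in>B. a \<bullet> b = 0))"

text \<open>For a reduced irreducible root system, types A, D, E are exactly those in which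
  all roots have the same length.  The inner product of the ambient type is moreover
  normalized so that this common squared length is 2.\<close>

definition simply_laced_normalized :: "'a::euclidean_space set \<Rightarrow> bool" where
  "simply_laced_normalized R \<longleftrightarrow> (\<forall>a\<in>R. a \<bullet> a = 2)"

inductive_set weyl_group :: "'a::real_inner set \<Rightarrow> ('a \<Rightarrow> 'a) set" for R :: "'a set" where
  id: "id \<in> weyl_group R"
| step: "a \<in> R \<Longrightarrow> w \<in> weyl_group R \<Longrightarrow> reflection a \<circ> w \<in> weyl_group R"

definition simple_roots :: "'a::euclidean_space set \<Rightarrow> 'a set \<Rightarrow> bool" where
  "simple_roots R P \<longleftrightarrow> P \<subseteq> R \<and> independent P \<and> span P = UNIV \<and>
     (\<forall>b\<in>R. \<exists>c :: 'a \<Rightarrow> int. b = (\<Sum>a\<in>P. of_int (c a) *\<^sub>R a) \<and>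
        ((\<forall>a\<in>P. 0 \<le> c a) \<or> (\<forall>a\<in>P. c a \<le> 0)))"

text \<open>\<open>\<alpha> P i\<close> is the simple root of the base \<open>P\<close> labelled by \<open>i\<close>; only the values
  for \<open>P\<close> a base and \<open>i \<in> I\<close> matter.\<close>

definition simple_root_labelling ::
    "'a::euclidean_space set \<Rightarrow> 'i set \<Rightarrow> ('a set \<Rightarrow> 'i \<Rightarrow> 'a) \<Rightarrow> bool" where
  "simple_root_labelling R I \<alpha> \<longleftrightarrow>
     (\<forall>P. simple_roots R P \<longrightarrow> bij_betw (\<alpha> P) I P) \<and>
     (\<forall>P w i. simple_roots R P \<and> w \<in> weyl_group R \<and> i \<in> I \<longrightarrow> w (\<alpha> P i) = \<alpha> (w ` P) i)"

text \<open>The numbers \<open>- (\<alpha> P i \<bullet> \<alpha> P j)\<close> do not depend on the base \<open>P\<close>, so any base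
  may be used to read off the edges of the Dynkin diagram.\<close>

definition dynkin_edge ::
    "'a::euclidean_space set \<Rightarrow> 'i set \<Rightarrow> ('a set \<Rightarrow> 'i \<Rightarrow> 'a) \<Rightarrow> 'i \<Rightarrow> 'i \<Rightarrow> bool" where
  "dynkin_edge R I \<alpha> i j \<longleftrightarrow> i \<in> I \<and> j \<in> I \<and> i \<noteq> j \<and>
     (\<exists>P. simple_roots R P \<and> - (\<alpha> P i \<bullet> \<alpha> P j) = 1)"


section \<open>Coxeter elements and compatible bases\<close>

definition coxeter_element :: "'a::euclidean_space set \<Rightarrow> ('a \<Rightarrow> 'a) \<Rightarrow> bool" where
  "coxeter_element R C \<longleftrightarrow>
     (\<exists>P as. simple_roots R P \<and> distinct as \<and> set as = P \<and>
        C = foldr (\<circ>) (map reflection as) id)"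

definition coxeter_number :: "('a \<Rightarrow> 'a) \<Rightarrow> nat" where
  "coxeter_number C = (LEAST n. 0 < n \<and> C ^^ n = id)"

text \<open>Coxeter elements have finite order, so nonnegative powers exhaust the orbit.\<close>

definition cyclic_orbit :: "('a \<Rightarrow> 'a) \<Rightarrow> 'a \<Rightarrow> 'a set" where
  "cyclic_orbit C x = {(C ^^ k) x | k. True}"

definition coxeter_expression ::
    "'i set \<Rightarrow> ('a set \<Rightarrow> 'i \<Rightarrow> 'a::euclidean_space) \<Rightarrow> ('a \<Rightarrow> 'a) \<Rightarrow> 'a set \<Rightarrow> 'i list \<Rightarrow> bool" where
  "coxeter_expression I \<alpha> C P xs \<longleftrightarrow> distinct xs \<and> set xs = I \<and>
     C = foldr (\<circ>) (map (\<lambda>i. reflection (\<alpha> P i)) xs) id"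

definition compatible_base ::
    "'a::euclidean_space set \<Rightarrow> 'i set \<Rightarrow> ('a set \<Rightarrow> 'i \<Rightarrow> 'a) \<Rightarrow> ('a \<Rightarrow> 'a) \<Rightarrow> 'a set \<Rightarrow> bool" where
  "compatible_base R I \<alpha> C P \<longleftrightarrow> simple_roots R P \<and> (\<exists>xs. coxeter_expression I \<alpha> C P xs)"

definition arrow ::
    "'a::euclidean_space set \<Rightarrow> 'i set \<Rightarrow> ('a set \<Rightarrow> 'i \<Rightarrow> 'a) \<Rightarrow> ('a \<Rightarrow> 'a) \<Rightarrow> 'a set
      \<Rightarrow> 'i \<Rightarrow> 'i \<Rightarrow> bool" where
  "arrow R I \<alpha> C P i j \<longleftrightarrow> dynkin_edge R I \<alpha> i j \<and>
     (\<exists>xs k l. coxeter_expression I \<alpha> C P xs \<and> k < l \<and> l < length xs \<and> xs ! k = i \<and> xs ! l = j)"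

definition beta ::
    "'a::euclidean_space set \<Rightarrow> 'i set \<Rightarrow> ('a set \<Rightarrow> 'i \<Rightarrow> 'a) \<Rightarrow> ('a \<Rightarrow> 'a) \<Rightarrow> 'a set
      \<Rightarrow> 'i \<Rightarrow> 'a" where
  "beta R I \<alpha> C P i = (\<Sum>j\<in>{j \<in> I. (arrow R I \<alpha> C P)\<^sup>*\<^sup>* j i}. \<alpha> P j)"


section \<open>The set \<open>Ihat\<close>, height functions and the map \<open>\<Phi>\<close>\<close>

text \<open>\<open>\<int>\<^sub>2\<close> and \<open>\<int>\<^sub>2\<^sub>h\<close> are represented by the canonical residues \<open>{0, 1}\<close> and
  \<open>{0..<2 * int h}\<close>.  In the following, \<open>E\<close> is the edge relation of a graph on \<open>I\<close>.\<close>

definition parity_function :: "'i set \<Rightarrow> ('i \<Rightarrow> 'i \<Rightarrow> bool) \<Rightarrow> ('i \<Rightarrow> int) \<Rightarrow> bool" where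
  "parity_function I E p \<longleftrightarrow> (\<forall>i\<in>I. p i \<in> {0, 1}) \<and>
     (\<forall>i\<in>I. \<forall>j\<in>I. E i j \<longrightarrow> [p i = p j + 1] (mod 2))"

definition Ihat :: "'i set \<Rightarrow> ('i \<Rightarrow> int) \<Rightarrow> nat \<Rightarrow> ('i \<times> int) set" where
  "Ihat I p h = {(i, n). i \<in> I \<and> n \<in> {0..<2 * int h} \<and> [p i + n = 0] (mod 2)}"

definition shift :: "nat \<Rightarrow> int \<Rightarrow> 'i \<times> int \<Rightarrow> 'i \<times> int" where
  "shift h k x = (fst x, (snd x + k) mod (2 * int h))"

definition height_function ::
    "'i set \<Rightarrow> ('i \<Rightarrow> 'i \<Rightarrow> bool) \<Rightarrow> ('i \<Rightarrow> int) \<Rightarrow> nat \<Rightarrow> ('i \<Rightarrow> int) \<Rightarrow> bool" where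
  "height_function I E p h \<eta> \<longleftrightarrow>
     (\<forall>i\<in>I. \<eta> i \<in> {0..<2 * int h}) \<and>
     (\<forall>i\<in>I. \<forall>j\<in>I. E i j \<longrightarrow>
        [\<eta> j = \<eta> i + 1] (mod (2 * int h)) \<or> [\<eta> j = \<eta> i - 1] (mod (2 * int h))) \<and>
     (\<forall>i\<in>I. [\<eta> i = p i] (mod 2))"

definition base_identification ::
    "'a::euclidean_space set \<Rightarrow> 'i set \<Rightarrow> ('a set \<Rightarrow> 'i \<Rightarrow> 'a) \<Rightarrow> ('a \<Rightarrow> 'a) \<Rightarrow> ('i \<Rightarrow> int) \<Rightarrow> 'i
      \<Rightarrow> ('a \<Rightarrow> 'i \<times> int) \<Rightarrow> bool" where
  "base_identification R I \<alpha> C p i0 \<Phi>0 \<longleftrightarrow>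
     (\<forall>P. compatible_base R I \<alpha> C P \<longrightarrow>
        bij_betw \<Phi>0 (cyclic_orbit C (beta R I \<alpha> C P i0))
          {x \<in> Ihat I p (coxeter_number C). fst x = i0} \<and>
        (\<forall>b \<in> cyclic_orbit C (beta R I \<alpha> C P i0).
           \<Phi>0 (C b) = shift (coxeter_number C) 2 (\<Phi>0 b)))"

definition root_identification ::
    "'a::euclidean_space set \<Rightarrow> 'i set \<Rightarrow> ('a set \<Rightarrow> 'i \<Rightarrow> 'a) \<Rightarrow> ('a \<Rightarrow> 'a) \<Rightarrow> ('i \<Rightarrow> int) \<Rightarrow> 'i
      \<Rightarrow> ('a \<Rightarrow> 'i \<times> int) \<Rightarrow> ('a \<Rightarrow> 'i \<times> int) \<Rightarrow> bool" where
  "root_identification R I \<alpha> C p i0 \<Phi>0 \<Phi> \<longleftrightarrow>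
     bij_betw \<Phi> R (Ihat I p (coxeter_number C)) \<and>
     (\<forall>b\<in>R. \<Phi> (C b) = shift (coxeter_number C) 2 (\<Phi> b)) \<and>
     (\<forall>P. compatible_base R I \<alpha> C P \<longrightarrow>
        (\<forall>i\<in>I. fst (\<Phi> (beta R I \<alpha> C P i)) = i) \<and>
        (\<forall>i j. arrow R I \<alpha> C P i j \<longrightarrow>
           \<Phi> (beta R I \<alpha> C P j) =
             (j, (snd (\<Phi> (beta R I \<alpha> C P i)) + 1) mod (2 * int (coxeter_number C)))) \<and>
        (\<forall>b \<in> cyclic_orbit C (beta R I \<alpha> C P i0). \<Phi> b = \<Phi>0 b))"


section \<open>Lattices\<close>

definition root_lattice :: "'a::euclidean_space set \<Rightarrow> 'a monoid" where
  "root_lattice R =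
     \<lparr>carrier = {(\<Sum>a\<in>R. of_int (c a) *\<^sub>R a) | c :: 'a \<Rightarrow> int. True},
      monoid.mult = (+), one = 0\<rparr>"

definition mesh_relation ::
    "'i set \<Rightarrow> ('i \<Rightarrow> 'i \<Rightarrow> bool) \<Rightarrow> nat \<Rightarrow> 'i \<times> int \<Rightarrow> 'i \<times> int \<Rightarrow>\<^sub>0 int" where
  "mesh_relation I E h x =
     frag_of x
     - (\<Sum>j\<in>{j \<in> I. E (fst x) j}. frag_of (j, (snd x + 1) mod (2 * int h)))
     + frag_of (shift h 2 x)"

definition mesh_subgroup ::
    "'i set \<Rightarrow> ('i \<Rightarrow> 'i \<Rightarrow> bool) \<Rightarrow> ('i \<Rightarrow> int) \<Rightarrow> nat \<Rightarrow> ('i \<times> int \<Rightarrow>\<^sub>0 int) set" where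
  "mesh_subgroup I E p h =
     generate (free_Abelian_group (Ihat I p h)) (mesh_relation I E h ` Ihat I p h)"

definition mesh_lattice ::
    "'i set \<Rightarrow> ('i \<Rightarrow> 'i \<Rightarrow> bool) \<Rightarrow> ('i \<Rightarrow> int) \<Rightarrow> nat \<Rightarrow> ('i \<times> int \<Rightarrow>\<^sub>0 int) set monoid" where
  "mesh_lattice I E p h = free_Abelian_group (Ihat I p h) Mod mesh_subgroup I E p h"

definition mesh_class ::
    "'i set \<Rightarrow> ('i \<Rightarrow> 'i \<Rightarrow> bool) \<Rightarrow> ('i \<Rightarrow> int) \<Rightarrow> nat \<Rightarrow> 'i \<times> int \<Rightarrow> ('i \<times> int \<Rightarrow>\<^sub>0 int) set" where
  "mesh_class I E p h x =
     mesh_subgroup I E p h #>\<^bsub>free_Abelian_group (Ihat I p h)\<^esub> frag_of x"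

text \<open>A finite family is a \<open>\<int>\<close>-basis of a multiplicatively written abelian group if it
  generates the group and satisfies only the trivial relation.\<close>

definition int_basis :: "('g, 'm) monoid_scheme \<Rightarrow> 'i set \<Rightarrow> ('i \<Rightarrow> 'g) \<Rightarrow> bool" where
  "int_basis G I x \<longleftrightarrow> finite I \<and> x ` I \<subseteq> carrier G \<and> generate G (x ` I) = carrier G \<and>
     (\<forall>c :: 'i \<Rightarrow> int.
        finprod G (\<lambda>i. x i [^]\<^bsub>G\<^esub> c i) I = \<one>\<^bsub>G\<^esub> \<longrightarrow> (\<forall>i\<in>I. c i = 0))"

end

theory Submission
  imports Defs
begin

text \<open>Write \<open>C = s\<^sub>1 \<cdots> s\<^sub>r\<close> and \<open>\<gamma>\<^sub>i = s\<^sub>1 \<cdots> s\<^sub>i\<^sub>-\<^sub>1 \<alpha>\<^sub>i\<close>.  Then \<open>C v = v - (\<Sum>i. (v, \<alpha>\<^sub>i) \<gamma>\<^sub>i)\<close> and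
  \<open>\<gamma>\<^sub>i\<close> is \<open>\<alpha>\<^sub>i\<close> plus the \<open>\<gamma>\<^sub>j\<close> with an arrow from \<open>j\<close> to \<open>i\<close>; since the Dynkin diagram has no
  cycles, this gives \<open>\<gamma>\<^sub>i = \<beta>\<^sub>i\<close>.  Applying the formula for \<open>C\<close> to \<open>v = \<alpha>\<^sub>i\<close> yields the mesh
  relation for \<open>\<beta>\<^sub>i\<close>, and powers of \<open>C\<close> carry it to all of \<open>Ihat\<close>, so that \<open>Q\<close> maps onto the
  root lattice.  The mesh relations also show that every slice \<open>(i, \<eta> i)\<close> generates \<open>Q\<close>.  Its
  image consists of \<open>r\<close> vectors spanning a space of dimension \<open>r\<close>, hence is linearly
  independent, so the map is injective and the slice is a basis.\<close>


section \<open>Weyl groups and bases\<close>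

lemma linear_reflection: "linear (reflection a)"
proof (rule linearI)
  fix x y :: 'a and r :: real
  show "reflection a (x + y) = reflection a x + reflection a y"
    by (simp add: reflection_def inner_add_left distrib_left add_divide_distrib scaleR_left_distrib)
  show "reflection a (r *\<^sub>R x) = r *\<^sub>R reflection a x"
    by (simp add: reflection_def scaleR_right_diff_distrib)
qed

lemma inner_reflection_reflection: "reflection a x \<bullet> reflection a y = x \<bullet> y"
proof (cases "a = 0")
  case True
  then show ?thesis by (simp add: reflection_def)
next
  case False
  then have *: "a \<bullet> a \<noteq> 0" by simp
  define u where "u = 2 * (x \<bullet> a) / (a \<bullet> a)"
  define v where "v = 2 * (y \<bullet> a) / (a \<bullet> a)"
  have "u * (a \<bullet> a) = 2 * (x \<bullet> a)" "v * (a \<bullet> a) = 2 * (y \<bullet> a)"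
    using * by (simp_all add: u_def v_def)
  moreover have "(x - u *\<^sub>R a) \<bullet> (y - v *\<^sub>R a) = x \<bullet> y - v * (x \<bullet> a) - u * (y \<bullet> a) + u * (v * (a \<bullet> a))"
    by (simp add: inner_diff_left inner_diff_right inner_commute[of a x] inner_commute[of a y] algebra_simps)
  moreover from calculation have "u * (v * (a \<bullet> a)) = v * (x \<bullet> a) + u * (y \<bullet> a)"
    by algebra
  ultimately show ?thesis
    unfolding reflection_def u_def[symmetric] v_def[symmetric] by linarith
qed

lemma reflection_norm_two: "a \<bullet> a = 2 \<Longrightarrow> reflection a x = x - (x \<bullet> a) *\<^sub>R a"
  by (simp add: reflection_def)

lemma weyl_group_linear: "w \<in> weyl_group R \<Longrightarrow> linear w"
proof (induction rule: weyl_group.induct)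
  case (step a w)
  then show ?case by (intro linear_compose linear_reflection)
qed (simp add: id_def linear_ident)

lemma weyl_group_inner: "w \<in> weyl_group R \<Longrightarrow> w x \<bullet> w y = x \<bullet> y"
  by (induction rule: weyl_group.induct) (auto simp: inner_reflection_reflection)

lemma weyl_group_inj:
  assumes "w \<in> weyl_group R"
  shows "inj w"
proof (rule injI)
  fix x y assume "w x = w y"
  then have "w (x - y) = 0" using weyl_group_linear[OF assms] by (simp add: linear_diff)
  then have "(x - y) \<bullet> (x - y) = 0" using weyl_group_inner[OF assms, of "x - y" "x - y"] by simp
  then show "x = y" by simp
qed

lemma weyl_group_image:
  assumes "root_system R" "w \<in> weyl_group R"
  shows "w ` R = R"
  using assms(2)
proof (induction rule: weyl_group.induct)
  case (step a w)
  then show ?case using assms(1) by (metis image_comp root_system_def)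
qed simp

text \<open>A linear map is determined by its values on the spanning set \<open>R\<close>, so
  restriction embeds the stabilizer into the finite set of maps from \<open>R\<close> to
  \<open>R\<close>.\<close>

lemma finite_linear_stabilizer:
  fixes R :: "'a::euclidean_space set"
  assumes "finite R" "span R = UNIV"
  shows "finite {w. linear w \<and> w ` R \<subseteq> R}"
proof -
  let ?S = "{w. linear w \<and> w ` R \<subseteq> R}"
  have "inj_on (\<lambda>w. restrict w R) ?S"
  proof (rule inj_onI)
    fix v w assume *: "v \<in> ?S" "w \<in> ?S" "restrict v R = restrict w R"
    have "v x = w x" if "x \<in> R" for x
      using *(3) that by (metis restrict_apply')
    then show "v = w"
      using linear_eq_on_span[of v w R] * assms(2) by auto
  qed
  moreover have "(\<lambda>w. restrict w R) ` ?S \<subseteq> PiE R (\<lambda>_. R)"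
    by auto
  ultimately show ?thesis
    using assms(1) by (meson finite_PiE finite_subset finite_imageD)
qed

lemma weyl_group_finite:
  assumes "root_system R"
  shows "finite (weyl_group R)"
proof -
  have "weyl_group R \<subseteq> {w. linear w \<and> w ` R \<subseteq> R}"
    using weyl_group_linear weyl_group_image[OF assms] by blast
  moreover have "finite {w. linear w \<and> w ` R \<subseteq> R}"
    using assms by (intro finite_linear_stabilizer) (auto simp: root_system_def)
  ultimately show ?thesis by (rule finite_subset)
qed

text \<open>All powers of \<open>w\<close> lie in a finite set, so two of them agree, and
  injectivity cancels the smaller one. This makes the \<open>LEAST\<close> in
  \<open>coxeter_number\<close> a genuine positive period.\<close>

lemma weyl_group_finite_order:
  assumes "root_system R" "w \<in> weyl_group R"
  shows "\<exists>n>0. w ^^ n = id"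
proof -
  have lin: "linear w" using assms weyl_group_linear by blast
  have inj: "inj w" using assms(2) by (rule weyl_group_inj)
  have "linear (w ^^ n) \<and> (w ^^ n) ` R \<subseteq> R" for n
  proof (induction n)
    case (Suc n)
    then have "linear (w ^^ Suc n)"
      unfolding funpow.simps by (intro linear_compose lin) simp
    moreover have "(w ^^ Suc n) ` R \<subseteq> R"
      using Suc weyl_group_image[OF assms] by auto
    ultimately show ?case by blast
  qed (simp add: id_def linear_ident)
  then have "range (\<lambda>n. w ^^ n) \<subseteq> {w. linear w \<and> w ` R \<subseteq> R}" by blast
  moreover have "finite {w. linear w \<and> w ` R \<subseteq> R}"
    using assms(1) by (intro finite_linear_stabilizer) (auto simp: root_system_def)
  ultimately have "finite (range (\<lambda>n. w ^^ n))" by (rule finite_subset)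
  then have "\<not> inj (\<lambda>n. w ^^ n)"
    using finite_imageD by fastforce
  then obtain m n where "m < n" "w ^^ m = w ^^ n"
    unfolding inj_def by (metis linorder_neqE_nat)
  then have "(w ^^ m) ((w ^^ (n - m)) x) = (w ^^ m) x" for x
    by (metis add_diff_inverse_nat comp_apply funpow_add less_imp_not_less)
  then have "(w ^^ (n - m)) x = x" for x
    using inj inj_fn by (metis injD)
  then show ?thesis using \<open>m < n\<close> by (intro exI[of _ "n - m"]) auto
qed

section \<open>Coefficients with respect to bases and spanning families\<close>

lemma independent_dual_vector:
  fixes P :: "'a::euclidean_space set" and g :: "'a \<Rightarrow> real"
  assumes "independent P"
  obtains v where "\<And>a. a \<in> P \<Longrightarrow> a \<bullet> v = g a"
proof -
  obtain f where f: "linear f" "\<forall>x\<in>P. f x = g x"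
    using linear_independent_extend[OF assms, of g] by blast
  \<comment> \<open>\<open>f\<close> is a linear functional, so its adjoint at 1 is the vector that
    represents it by the inner product.\<close>
  show thesis
    by (rule that[of "adjoint f 1"]) (use f in \<open>simp add: adjoint_works\<close>)
qed

text \<open>A vector positive on \<open>P\<close> decides between the two sign alternatives:
  nonpositive coefficients would force \<open>b \<bullet> v \<le> 0\<close>.\<close>

lemma simple_roots_nonneg_coeffs:
  assumes "simple_roots R P" "b \<in> R" "\<And>a. a \<in> P \<Longrightarrow> 0 < a \<bullet> v" "0 < b \<bullet> v"
  obtains c :: "'a::euclidean_space \<Rightarrow> int"
    where "b = (\<Sum>a\<in>P. of_int (c a) *\<^sub>R a)" "\<And>a. a \<in> P \<Longrightarrow> 0 \<le> c a"
proof -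
  obtain c :: "'a \<Rightarrow> int" where c: "b = (\<Sum>a\<in>P. of_int (c a) *\<^sub>R a)"
    "(\<forall>a\<in>P. 0 \<le> c a) \<or> (\<forall>a\<in>P. c a \<le> 0)"
    using assms(1,2) unfolding simple_roots_def by blast
  have "b \<bullet> v = (\<Sum>a\<in>P. of_int (c a) * (a \<bullet> v))"
    by (simp add: c(1) inner_sum_left)
  moreover have "(\<Sum>a\<in>P. of_int (c a) * (a \<bullet> v)) \<le> 0" if "\<forall>a\<in>P. c a \<le> 0"
    by (rule sum_nonpos) (use that assms(3) in \<open>simp add: mult_nonpos_nonneg less_imp_le\<close>)
  ultimately show thesis using that c assms(4) by fastforce
qed

lemma independent_coeffs_eq:
  fixes c d :: "'a::real_vector \<Rightarrow> real"
  assumes "independent P" "finite P"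
    and "(\<Sum>a\<in>P. c a *\<^sub>R a) = (\<Sum>a\<in>P. d a *\<^sub>R a)" "a \<in> P"
  shows "c a = d a"
proof -
  have "(\<Sum>a\<in>P. (c a - d a) *\<^sub>R a) = 0"
    using assms(3) by (simp add: scaleR_left_diff_distrib sum_subtractf)
  then have "c a - d a = 0"
    using independentD[OF assms(1,2) subset_refl, of "\<lambda>a. c a - d a" a] assms(4) by blast
  then show ?thesis by simp
qed

lemma independent_family_coeffs:
  fixes f :: "'i \<Rightarrow> 'a::real_vector"
  assumes "finite I" "inj_on f I" "independent (f ` I)"
    and "(\<Sum>i\<in>I. c i *\<^sub>R f i) = 0" "i \<in> I"
  shows "c i = 0"
proof -
  have "(\<Sum>x\<in>f ` I. c (the_inv_into I f x) *\<^sub>R x) = 0"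
    using assms(4) by (subst sum.reindex[OF assms(2)])
      (simp add: the_inv_into_f_f[OF assms(2)] cong: sum.cong)
  then have "c (the_inv_into I f (f i)) = 0"
    using independentD[OF assms(3) _ subset_refl, of "\<lambda>x. c (the_inv_into I f x)" "f i"]
      assms(1,5) by blast
  then show ?thesis using the_inv_into_f_f[OF assms(2,5)] by simp
qed

text \<open>A spanning family of at most \<open>DIM('a)\<close> vectors is a basis. This is the
  dimension count that later yields independence of the slices.\<close>

lemma spanning_family_coeffs:
  fixes f :: "'i \<Rightarrow> 'a::euclidean_space"
  assumes "finite I" "inj_on f I" "card I \<le> DIM('a)" "span (f ` I) = UNIV"
    and "(\<Sum>i\<in>I. c i *\<^sub>R f i) = 0" "i \<in> I"
  shows "c i = 0"
proof -
  have "independent (f ` I)"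
    using assms card_image[OF assms(2)]
    by (intro card_le_dim_spanning[of _ UNIV]) (auto simp: dim_UNIV)
  then show ?thesis using independent_family_coeffs[OF assms(1,2) _ assms(5,6)] by blast
qed

text \<open>Simple roots are the indecomposable positive roots, so a base is determined by any
  vector that is positive on it.\<close>

lemma simple_roots_subset:
  assumes R: "\<And>a. a \<in> R \<Longrightarrow> a \<bullet> a = 2"
    and P: "simple_roots R P" and Q: "simple_roots R Q"
    and vP: "\<And>a. a \<in> P \<Longrightarrow> 0 < a \<bullet> v" and vQ: "\<And>a. a \<in> Q \<Longrightarrow> 0 < a \<bullet> v"
  shows "P \<subseteq> Q"
proof
  fix a assume a: "a \<in> P"
  have fin: "finite P" "finite Q" and ind: "independent P"
    and sub: "P \<subseteq> R" "Q \<subseteq> R"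
    using P Q by (auto simp: simple_roots_def independent_imp_finite)
  obtain c where c: "a = (\<Sum>b\<in>Q. of_int (c b) *\<^sub>R b)" "\<And>b. b \<in> Q \<Longrightarrow> (0::int) \<le> c b"
    using simple_roots_nonneg_coeffs[OF Q _ vQ vP[OF a]] a sub by blast
  have "\<exists>d :: 'a \<Rightarrow> int. b = (\<Sum>a\<in>P. of_int (d a) *\<^sub>R a) \<and> (\<forall>a\<in>P. 0 \<le> d a)" if "b \<in> Q" for b
    using simple_roots_nonneg_coeffs[OF P _ vP vQ[OF that]] that sub by (metis subsetD)
  then obtain d :: "'a \<Rightarrow> 'a \<Rightarrow> int" where
    d: "\<And>b. b \<in> Q \<Longrightarrow> b = (\<Sum>a\<in>P. of_int (d b a) *\<^sub>R a)" "\<And>b a. b \<in> Q \<Longrightarrow> a \<in> P \<Longrightarrow> 0 \<le> d b a"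
    by metis
  have "a \<noteq> 0" using R a sub by force
  then obtain b where b: "b \<in> Q" "c b > 0"
    using c by (metis (no_types, lifting) of_int_0 order_le_less scale_eq_0_iff sum.neutral)
  \<comment> \<open>The root \<open>a\<close> is expanded over \<open>Q\<close> and then back over
    \<open>P\<close>. Comparing coefficients makes a sum of nonnegative integer products vanish at
    every \<open>e \<noteq> a\<close>, so any \<open>b\<close> occurring in \<open>a\<close> is a
    multiple of \<open>a\<close>.\<close>
  have "(\<Sum>e\<in>P. (if e = a then 1 else 0) *\<^sub>R e) = a"
    using fin a by (simp add: if_distrib[of "\<lambda>x. x *\<^sub>R _"] cong: if_cong)
  also have "a = (\<Sum>b\<in>Q. of_int (c b) *\<^sub>R (\<Sum>e\<in>P. of_int (d b e) *\<^sub>R e))"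
    using c(1) d(1) by (metis (no_types, lifting) sum.cong)
  also have "\<dots> = (\<Sum>e\<in>P. (\<Sum>b\<in>Q. of_int (c b * d b e)) *\<^sub>R e)"
    by (simp add: scaleR_sum_right scaleR_sum_left sum.swap[of _ Q])
  finally have "(\<Sum>e\<in>P. (if e = a then 1 else 0) *\<^sub>R e) = (\<Sum>e\<in>P. (\<Sum>b\<in>Q. of_int (c b * d b e)) *\<^sub>R e)" .
  from independent_coeffs_eq[OF ind fin(1) this]
  have eq: "(if e = a then 1 else 0) = (\<Sum>b\<in>Q. real_of_int (c b * d b e))" if "e \<in> P" for e
    using that by simp
  have "d b e = 0" if e: "e \<in> P" "e \<noteq> a" for e
  proof -
    have "real_of_int (\<Sum>b\<in>Q. c b * d b e) = 0"
      using eq[OF e(1)] e(2) by simp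
    then have "(\<Sum>b\<in>Q. c b * d b e) = 0"
      by (simp only: of_int_eq_0_iff)
    moreover have "0 \<le> c b * d b e" if "b \<in> Q" for b
      using that c(2) d(2) e(1) by simp
    ultimately have "c b * d b e = 0"
      using sum_nonneg_eq_0_iff[OF fin(2), of "\<lambda>b. c b * d b e"] b(1) by blast
    then show ?thesis using b by simp
  qed
  then have "b = (\<Sum>e\<in>{a}. of_int (d b e) *\<^sub>R e)"
    using fin a by (subst d(1)[OF b(1)], intro sum.mono_neutral_right) auto
  then have ba: "b = of_int (d b a) *\<^sub>R a" by simp
  \<comment> \<open>Equal root lengths leave only the factors 1 and -1, and nonnegativity of
    \<open>d\<close> selects 1.\<close>
  have "b \<bullet> b = (real_of_int (d b a))\<^sup>2 * (a \<bullet> a)"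
    by (subst (1 2) ba) (simp add: power2_eq_square)
  then have "(real_of_int (d b a))\<^sup>2 = 1"
    using R[of b] R[of a] a b sub by (simp add: subset_iff)
  then have "d b a = 1 \<or> d b a = -1"
    by (auto simp: power2_eq_1_iff)
  then have "d b a = 1" using d(2)[OF b(1) a] by linarith
  then have "b = a" using ba by simp
  then show "a \<in> Q" using b by simp
qed

section \<open>The Weyl group action on bases, and inner products of simple roots\<close>

lemma simple_roots_weyl_image:
  assumes R: "root_system R" and w: "w \<in> weyl_group R" and P: "simple_roots R P"
  shows "simple_roots R (w ` P)"
proof -
  have lin: "linear w" using w weyl_group_linear by blast
  have inj: "inj w" using w by (rule weyl_group_inj)
  have surj: "surj w" using lin inj by (simp add: linear_injective_imp_surjective)
  show ?thesis
    unfolding simple_roots_def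
  proof (intro conjI ballI)
    show "w ` P \<subseteq> R"
      using weyl_group_image[OF R w] P by (auto simp: simple_roots_def)
    show "independent (w ` P)"
      using linear_independent_injective_image[OF lin] inj P by (simp add: simple_roots_def)
    show "span (w ` P) = UNIV"
      using linear_span_image[OF lin] P surj by (simp add: simple_roots_def)
    fix b assume "b \<in> R"
    then obtain b' where b': "b' \<in> R" "b = w b'"
      using weyl_group_image[OF R w] by auto
    then obtain c :: "'a \<Rightarrow> int" where c: "b' = (\<Sum>a\<in>P. of_int (c a) *\<^sub>R a)"
      "(\<forall>a\<in>P. 0 \<le> c a) \<or> (\<forall>a\<in>P. c a \<le> 0)"
      using P by (metis simple_roots_def)
    have "b = (\<Sum>a\<in>w ` P. of_int (c (inv_into UNIV w a)) *\<^sub>R a)"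
      using inj lin unfolding b'(2) c(1)
      by (subst sum.reindex) (auto simp: linear_sum linear_scale inj_on_def)
    then show "\<exists>c :: 'a \<Rightarrow> int. b = (\<Sum>a\<in>w ` P. of_int (c a) *\<^sub>R a) \<and>
        ((\<forall>a\<in>w ` P. 0 \<le> c a) \<or> (\<forall>a\<in>w ` P. c a \<le> 0))"
      using c(2) inj by (intro exI[of _ "\<lambda>a. c (inv_into UNIV w a)"]) auto
  qed
qed

text \<open>The number \<open>b \<bullet> v\<close> is the height of \<open>b\<close>, a sum of
  coefficients of one sign, which vanishes only if all of them do.\<close>

lemma simple_roots_regular:
  assumes R: "0 \<notin> R" and P: "simple_roots R P" and "\<And>a. a \<in> P \<Longrightarrow> a \<bullet> v = 1" "b \<in> R"
  shows "b \<bullet> v \<noteq> 0"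
proof
  assume 0: "b \<bullet> v = 0"
  obtain c :: "'a \<Rightarrow> int" where c: "b = (\<Sum>a\<in>P. of_int (c a) *\<^sub>R a)"
    "(\<forall>a\<in>P. 0 \<le> c a) \<or> (\<forall>a\<in>P. c a \<le> 0)"
    using assms unfolding simple_roots_def by blast
  have fin: "finite P" using P by (auto simp: simple_roots_def independent_imp_finite)
  have "b \<bullet> v = of_int (\<Sum>a\<in>P. c a)"
    using assms(3) by (simp add: c(1) inner_sum_left)
  then have "(\<Sum>a\<in>P. c a) = 0" using 0 by (metis of_int_eq_0_iff)
  then have "\<forall>a\<in>P. c a = 0"
    using c(2)
  proof (elim disjE)
    assume "\<forall>a\<in>P. c a \<le> 0" "(\<Sum>a\<in>P. c a) = 0"
    then show ?thesis
      using sum_nonneg_eq_0_iff[OF fin, of "\<lambda>a. - c a"] by (simp add: sum_negf)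
  qed (use sum_nonneg_eq_0_iff[OF fin, of c] in simp)
  then have "b = 0" using c(1) by simp
  then show False using assms by simp
qed

text \<open>Let \<open>u\<close> and \<open>v\<close> define the heights for \<open>P\<close> and
  \<open>Q\<close>. An element \<open>w\<close> maximizing \<open>w v \<bullet> u\<close> over the
  finite Weyl group makes \<open>w v\<close> positive on \<open>P\<close>. It is positive on the
  image of \<open>Q\<close> as well, and a base is determined by such a vector.\<close>

lemma weyl_group_transitive_on_bases:
  assumes R: "root_system R" and two: "\<And>a. a \<in> R \<Longrightarrow> a \<bullet> a = 2"
    and P: "simple_roots R P" and Q: "simple_roots R Q"
  obtains w where "w \<in> weyl_group R" "w ` Q = P"
proof -
  obtain u where u: "\<And>a. a \<in> P \<Longrightarrow> a \<bullet> u = 1"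
    using independent_dual_vector[of P "\<lambda>_. 1"] P by (auto simp: simple_roots_def)
  obtain v where v: "\<And>a. a \<in> Q \<Longrightarrow> a \<bullet> v = 1"
    using independent_dual_vector[of Q "\<lambda>_. 1"] Q by (auto simp: simple_roots_def)
  obtain w where w: "w \<in> weyl_group R" and max: "\<And>x. x \<in> weyl_group R \<Longrightarrow> x v \<bullet> u \<le> w v \<bullet> u"
  proof -
    let ?S = "(\<lambda>w. w v \<bullet> u) ` weyl_group R"
    have S: "finite ?S" "?S \<noteq> {}"
      using weyl_group_finite[OF R] weyl_group.id[of R] by auto
    then obtain w where "w \<in> weyl_group R" "Max ?S = w v \<bullet> u"
      using Max_in[OF S] unfolding image_iff by blast
    then show thesis using Max_ge[OF S(1)] that by (metis image_eqI)
  qed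
  have wQ: "simple_roots R (w ` Q)" by (rule simple_roots_weyl_image[OF R w Q])
  have one: "a \<bullet> w v = 1" if "a \<in> w ` Q" for a
    using that weyl_group_inner[OF w] v by auto
  have pos: "0 < a \<bullet> w v" if a: "a \<in> P" for a
  proof -
    have aR: "a \<in> R" using a P by (auto simp: simple_roots_def)
    have "reflection a \<circ> w \<in> weyl_group R" using aR w by (rule weyl_group.step)
    \<comment> \<open>Reflecting in \<open>a\<close> changes \<open>w v \<bullet> u\<close> by
      \<open>-(w v \<bullet> a) * (a \<bullet> u)\<close>, which maximality forbids to be
      positive.\<close>
    from max[OF this] have "0 \<le> (w v \<bullet> a) * (a \<bullet> u)"
      by (simp add: reflection_norm_two[OF two[OF aR]] inner_diff_left)
    then have "0 \<le> a \<bullet> w v" using u[OF a] by (simp add: inner_commute)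
    moreover have "a \<bullet> w v \<noteq> 0"
      using simple_roots_regular[OF _ wQ one aR] R by (simp add: root_system_def)
    ultimately show ?thesis by simp
  qed
  have "P = w ` Q"
    using simple_roots_subset[OF two P wQ pos] simple_roots_subset[OF two wQ P _ pos] one
    by (metis subset_antisym zero_less_one)
  then show thesis using that w by blast
qed

text \<open>The inner product is an integer, and positivity of the norms of \<open>a + b\<close> and
  \<open>a - b\<close> puts it strictly between -2 and 2. The value 1 would make
  \<open>b - a\<close> a root with coefficients of both signs.\<close>

lemma simple_roots_inner:
  assumes R: "root_system R" and two: "\<And>a. a \<in> R \<Longrightarrow> a \<bullet> a = 2"
    and P: "simple_roots R P" and ab: "a \<in> P" "b \<in> P" "a \<noteq> b"
  shows "a \<bullet> b = 0 \<or> a \<bullet> b = -1"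
proof -
  have fin: "finite P" and ind: "independent P" and abR: "a \<in> R" "b \<in> R"
    using P ab by (auto simp: simple_roots_def independent_imp_finite)
  have "2 * (b \<bullet> a) / (a \<bullet> a) \<in> \<int>" using R abR by (simp add: root_system_def)
  then have "a \<bullet> b \<in> \<int>" using two[OF abR(1)] by (simp add: inner_commute)
  then obtain n where n: "a \<bullet> b = of_int n" by (auto elim: Ints_cases)
  have ne: "x *\<^sub>R a + y *\<^sub>R b \<noteq> 0" if "x \<noteq> 0" for x y
  proof
    assume 0: "x *\<^sub>R a + y *\<^sub>R b = 0"
    have "(\<Sum>e\<in>{a,b}. (if e = a then x else y) *\<^sub>R e) = 0"
      using ab(3) 0 by simp
    then have "(if a = a then x else y) = 0"
      using independentD[OF ind, of "{a,b}" "\<lambda>e. if e = a then x else y" a] ab by auto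
    then show False using that by simp
  qed
  have "0 < (a + b) \<bullet> (a + b)" using ne[of 1 1] by simp
  then have "- 2 < a \<bullet> b" using two abR by (simp add: inner_add_left inner_add_right inner_commute)
  have "0 < (a - b) \<bullet> (a - b)" using ne[of 1 "-1"] by simp
  then have "a \<bullet> b < 2" using two abR by (simp add: inner_diff_left inner_diff_right inner_commute)
  have "n \<noteq> 1"
  proof
    assume "n = 1"
    then have "reflection a b = b - a"
      using n by (simp add: reflection_norm_two[OF two[OF abR(1)]] inner_commute)
    moreover have "reflection a b \<in> R" using R abR by (auto simp: root_system_def)
    ultimately obtain c :: "'a \<Rightarrow> int" where c: "b - a = (\<Sum>e\<in>P. of_int (c e) *\<^sub>R e)"
      "(\<forall>a\<in>P. 0 \<le> c a) \<or> (\<forall>a\<in>P. c a \<le> 0)"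
      using P unfolding simple_roots_def by metis
    \<comment> \<open>The coefficients of \<open>b - a\<close> over \<open>P\<close>: 1 at
      \<open>b\<close>, -1 at \<open>a\<close>, and 0 elsewhere.\<close>
    let ?d = "\<lambda>e. (if e = b then 1 else 0) - (if e = a then 1 else (0::real))"
    have "(\<Sum>e\<in>P. ?d e *\<^sub>R e) = b - a"
      using fin ab by (simp add: scaleR_left_diff_distrib sum_subtractf
          if_distrib[of "\<lambda>x. x *\<^sub>R _"] cong: if_cong)
    then have "of_int (c e) = ?d e" if "e \<in> P" for e
      using independent_coeffs_eq[OF ind fin _ that, of "\<lambda>e. of_int (c e)" ?d] c(1) by simp
    from this[OF ab(1)] this[OF ab(2)] have "c a = -1" "c b = 1"
      using ab(3) by auto
    then show False using c(2) ab by force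
  qed
  then have "n = 0 \<or> n = -1"
    using \<open>- 2 < a \<bullet> b\<close> \<open>a \<bullet> b < 2\<close> n by linarith
  then show ?thesis using n by auto
qed


section \<open>Products of simple reflections\<close>

locale simply_laced_base =
  fixes I :: "'i set" and a :: "'i \<Rightarrow> 'a::euclidean_space"
  assumes inj_a: "inj_on a I" and indep_a: "independent (a ` I)"
    and norm_two: "i \<in> I \<Longrightarrow> a i \<bullet> a i = 2"
    and off_diag: "i \<in> I \<Longrightarrow> j \<in> I \<Longrightarrow> i \<noteq> j \<Longrightarrow> a i \<bullet> a j = 0 \<or> a i \<bullet> a j = -1"
begin

definition adj :: "'i \<Rightarrow> 'i \<Rightarrow> bool" where
  "adj i j \<longleftrightarrow> i \<in> I \<and> j \<in> I \<and> i \<noteq> j \<and> a i \<bullet> a j = -1"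

lemma finite_I: "finite I"
  using inj_a indep_a independent_imp_finite finite_image_iff by blast

lemma adj_sym: "adj i j \<Longrightarrow> adj j i"
  by (auto simp: adj_def inner_commute)

lemma adj_in: "adj i j \<Longrightarrow> i \<in> I" "adj i j \<Longrightarrow> j \<in> I" "\<not> adj i i"
  by (auto simp: adj_def)

text \<open>Independence with coefficients 0 and 1: a set of vertices can be read off from the sum
  of its simple roots. This later recovers the ancestors of a vertex from a root.\<close>

lemma subset_sum_inj:
  assumes "A \<subseteq> I" "B \<subseteq> I" "(\<Sum>i\<in>A. a i) = (\<Sum>i\<in>B. a i)"
  shows "A = B"
proof -
  let ?c = "\<lambda>i. of_bool (i \<in> A) - of_bool (i \<in> B) :: real"
  have *: "(\<Sum>i\<in>I. of_bool (i \<in> S) *\<^sub>R a i) = (\<Sum>i\<in>S. a i)" if "S \<subseteq> I" for S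
    using sum.mono_neutral_right[OF finite_I that, of "\<lambda>i. of_bool (i \<in> S) *\<^sub>R a i"] by simp
  have "(\<Sum>i\<in>I. ?c i *\<^sub>R a i) = 0"
    using assms * by (simp add: scaleR_left_diff_distrib sum_subtractf)
  note c = independent_family_coeffs[OF finite_I inj_a indep_a this]
  have "i \<in> A \<longleftrightarrow> i \<in> B" if "i \<in> I" for i
    using c[OF that] by (cases "i \<in> A"; cases "i \<in> B") auto
  then show ?thesis using assms(1,2) by blast
qed

text \<open>The squared norm of the sum of the simple roots in \<open>A\<close> is twice the difference between
  the numbers of vertices and of edges; so the diagram contains no cycles.\<close>

lemma card_edges_less:
  assumes A: "A \<subseteq> I" "A \<noteq> {}" and F: "F \<subseteq> A \<times> A"
    and adj: "\<And>i j. (i, j) \<in> F \<Longrightarrow> adj i j" and asym: "\<And>i j. (i, j) \<in> F \<Longrightarrow> (j, i) \<notin> F"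
  shows "card F < card A"
proof -
  have fin: "finite A" "finite F"
    using A F finite_I by (meson finite_subset finite_SigmaI)+
  let ?g = "\<lambda>(i, j). a i \<bullet> a j"
  let ?D = "(\<lambda>i. (i, i)) ` A" and ?F' = "prod.swap ` F"
  have "(\<Sum>i\<in>A. a i) \<noteq> 0"
    using subset_sum_inj[of A "{}"] A by auto
  then have "0 < (\<Sum>i\<in>A. a i) \<bullet> (\<Sum>i\<in>A. a i)" by simp
  also have "\<dots> = sum ?g (A \<times> A)"
    by (simp only: inner_sum_left, simp only: inner_sum_right sum.cartesian_product)
  \<comment> \<open>Pairs outside the diagonal, \<open>F\<close> and its reversal contribute 0 or
    -1, so dropping them can only increase the sum.\<close>
  also have "\<dots> \<le> sum ?g (?D \<union> (F \<union> ?F'))"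
  proof -
    have "?D \<union> (F \<union> ?F') \<subseteq> A \<times> A" using F by auto
    then have "sum ?g (A \<times> A) =
        sum ?g (A \<times> A - (?D \<union> (F \<union> ?F'))) + sum ?g (?D \<union> (F \<union> ?F'))"
      using fin by (intro sum.subset_diff) auto
    moreover have "sum ?g (A \<times> A - (?D \<union> (F \<union> ?F'))) \<le> 0"
    proof (rule sum_nonpos)
      fix x assume "x \<in> A \<times> A - (?D \<union> (F \<union> ?F'))"
      then show "?g x \<le> 0" using A off_diag by (cases x) (fastforce simp: subset_iff)
    qed
    ultimately show ?thesis by simp
  qed
  also have "\<dots> = sum ?g ?D + (sum ?g F + sum ?g ?F')"
  proof -
    have "F \<inter> ?F' = {}" using asym by auto
    moreover have "?D \<inter> (F \<union> ?F') = {}" using adj adj_in(3) by force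
    ultimately show ?thesis using fin by (simp add: sum.union_disjoint)
  qed
  also have "sum ?g ?D = 2 * card A"
    using A norm_two by (subst sum.reindex) (auto simp: inj_on_def subset_iff)
  also have "sum ?g F = - real (card F)"
    using adj by (subst sum.cong[OF refl, of _ _ "\<lambda>_. -1"]) (auto simp: adj_def)
  also have "sum ?g ?F' = - real (card F)"
    using adj adj_sym by (subst sum.reindex, simp, subst sum.cong[OF refl, of _ _ "\<lambda>_. -1"])
       (auto simp: adj_def inner_commute)
  finally show ?thesis by simp
qed

text \<open>Otherwise choosing a predecessor of every vertex gives as many edges as vertices.\<close>

lemma orientation_has_source:
  assumes A: "A \<subseteq> I" "A \<noteq> {}"
    and D: "\<And>i j. D i j \<Longrightarrow> adj i j" "\<And>i j. D i j \<Longrightarrow> \<not> D j i"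
  shows "\<exists>i\<in>A. \<forall>j\<in>A. \<not> D j i"
proof (rule ccontr)
  assume "\<not> ?thesis"
  then obtain f where f: "\<And>i. i \<in> A \<Longrightarrow> f i \<in> A \<and> D (f i) i" by metis
  let ?F = "(\<lambda>i. (f i, i)) ` A"
  have "card ?F < card A"
  proof (rule card_edges_less[OF A])
    show "?F \<subseteq> A \<times> A" using f by blast
    show "adj i j" if "(i, j) \<in> ?F" for i j using that f D(1) by blast
    show "(j, i) \<notin> ?F" if "(i, j) \<in> ?F" for i j
    proof
      assume "(j, i) \<in> ?F"
      then have "D j i" using f by blast
      moreover have "D i j" using that f by blast
      ultimately show False using D(2) by blast
    qed
  qed
  moreover have "card ?F = card A" by (intro card_image) (auto simp: inj_on_def)
  ultimately show False by simp
qed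

section \<open>Coxeter words and the roots attached to their letters\<close>

definition cox :: "'i list \<Rightarrow> 'a \<Rightarrow> 'a" where
  "cox xs = foldr (\<circ>) (map (\<lambda>i. reflection (a i)) xs) id"

lemma cox_simps [simp]: "cox [] = id" "cox (i # xs) = reflection (a i) \<circ> cox xs"
  by (simp_all add: cox_def)

lemma cox_append: "cox (xs @ ys) = cox xs \<circ> cox ys"
  by (induction xs) (auto simp: fun_eq_iff)

lemma linear_cox: "linear (cox xs)"
  by (induction xs) (auto simp: id_def linear_ident intro: linear_compose[OF _ linear_reflection, unfolded comp_def])

definition pos :: "'i list \<Rightarrow> 'i \<Rightarrow> nat" where
  "pos xs i = length (takeWhile (\<lambda>j. j \<noteq> i) xs)"

lemma pos_less: "i \<in> set xs \<Longrightarrow> pos xs i < length xs"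
  unfolding pos_def by (induction xs) auto

lemma nth_pos: "i \<in> set xs \<Longrightarrow> xs ! pos xs i = i"
  unfolding pos_def by (induction xs) auto

lemma pos_nth: "distinct xs \<Longrightarrow> k < length xs \<Longrightarrow> pos xs (xs ! k) = k"
  using nth_eq_iff_index_eq[of xs "pos xs (xs ! k)" k] nth_pos[of "xs ! k" xs] pos_less[of "xs ! k" xs]
  by simp

lemma pos_inj: "i \<in> set xs \<Longrightarrow> j \<in> set xs \<Longrightarrow> pos xs i = pos xs j \<Longrightarrow> i = j"
  by (metis nth_pos)

lemma pos_append:
  "i \<in> set xs \<Longrightarrow> pos (xs @ ys) i = pos xs i"
  "y \<notin> set xs \<Longrightarrow> pos (xs @ y # ys) y = length xs"
  unfolding pos_def by (auto simp: takeWhile_append1) (subst takeWhile_append2, auto)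

text \<open>These are the positive roots that the inverse of \<open>cox xs\<close> makes negative.\<close>

definition gam :: "'i list \<Rightarrow> 'i \<Rightarrow> 'a" where
  "gam xs i = cox (take (pos xs i) xs) (a i)"

lemma gam_append:
  "i \<in> set xs \<Longrightarrow> gam (xs @ ys) i = gam xs i"
  "y \<notin> set xs \<Longrightarrow> gam (xs @ y # ys) y = cox xs (a y)"
  using pos_less[of i xs] by (auto simp: gam_def pos_append)

text \<open>Appending a letter \<open>y\<close> applies the last reflection first, which subtracts
  \<open>(v \<bullet> a y)\<close> times \<open>cox xs (a y)\<close>, the new \<open>gam\<close>.
  The earlier \<open>gam\<close> depend only on prefixes and do not change.\<close>

lemma cox_eq:
  assumes "distinct xs" "set xs \<subseteq> I"
  shows "cox xs v = v - (\<Sum>i\<in>set xs. (v \<bullet> a i) *\<^sub>R gam xs i)"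
  using assms
proof (induction xs rule: rev_induct)
  case (snoc y xs)
  then have y: "y \<in> I" "y \<notin> set xs" by auto
  have "cox (xs @ [y]) v = cox xs (v - (v \<bullet> a y) *\<^sub>R a y)"
    using y by (simp add: cox_append reflection_norm_two norm_two)
  also have "\<dots> = cox xs v - (v \<bullet> a y) *\<^sub>R gam (xs @ [y]) y"
    using y by (simp add: linear_diff[OF linear_cox] linear_scale[OF linear_cox] gam_append)
  also have "cox xs v = v - (\<Sum>i\<in>set xs. (v \<bullet> a i) *\<^sub>R gam (xs @ [y]) i)"
    using snoc by (simp add: gam_append cong: sum.cong)
  finally show ?case using y by (simp add: algebra_simps)
qed simp

text \<open>Apply \<open>cox_eq\<close> to the prefix before \<open>i\<close> with
  \<open>v = a i\<close>: only neighbours of \<open>i\<close> occurring earlier contribute, each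
  with coefficient -1.\<close>

lemma gam_rec:
  assumes "distinct xs" "set xs \<subseteq> I" "i \<in> set xs"
  shows "gam xs i = a i + (\<Sum>j\<in>{j \<in> set xs. adj j i \<and> pos xs j < pos xs i}. gam xs j)"
proof -
  obtain us ws where xs: "xs = us @ i # ws" "i \<notin> set us"
    using assms(3) by (meson split_list_first)
  have d: "distinct us" "set us \<subseteq> I" using assms xs by auto
  have i: "pos xs i = length us" using xs by (simp add: pos_append)
  have set_us: "j \<in> set us \<longleftrightarrow> pos xs j < pos xs i" if "j \<in> set xs" for j
  proof
    assume "j \<in> set us"
    then show "pos xs j < pos xs i" using xs i pos_less by (simp add: pos_append)
  next
    assume "pos xs j < pos xs i"
    then show "j \<in> set us"
      using nth_pos[OF that] i xs by (metis nth_append nth_mem)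
  qed
  have "gam xs i = cox us (a i)" using xs by (simp add: gam_append)
  also have "\<dots> = a i - (\<Sum>j\<in>set us. (a i \<bullet> a j) *\<^sub>R gam xs j)"
    using cox_eq[OF d] xs by (simp add: gam_append cong: sum.cong)
  also have "(\<Sum>j\<in>set us. (a i \<bullet> a j) *\<^sub>R gam xs j) = (\<Sum>j\<in>set us. if adj j i then - gam xs j else 0)"
  proof (rule sum.cong[OF refl])
    fix j assume j: "j \<in> set us"
    then have "j \<noteq> i" "j \<in> I" "i \<in> I" using xs assms by auto
    then show "(a i \<bullet> a j) *\<^sub>R gam xs j = (if adj j i then - gam xs j else 0)"
      using off_diag[of i j] by (auto simp: adj_def inner_commute)
  qed
  also have "\<dots> = (\<Sum>j\<in>{j \<in> set us. adj j i}. - gam xs j)"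
    by (subst sum.inter_filter) auto
  also have "{j \<in> set us. adj j i} = {j \<in> set xs. adj j i \<and> pos xs j < pos xs i}"
    using set_us xs by auto
  finally show ?thesis by (simp add: sum_negf)
qed

section \<open>Sums over oriented paths, and the dependence on the word\<close>

definition arr :: "'i list \<Rightarrow> 'i \<Rightarrow> 'i \<Rightarrow> bool" where
  "arr xs i j \<longleftrightarrow> adj i j \<and> pos xs i < pos xs j"

text \<open>This is the form of \<open>beta\<close> with \<open>arrow\<close> replaced by the order
  of a single word; the two relations are shown to agree in the main proof.\<close>

definition pathsum :: "'i list \<Rightarrow> 'i \<Rightarrow> 'a" where
  "pathsum xs i = (\<Sum>j\<in>{j \<in> I. (arr xs)\<^sup>*\<^sup>* j i}. a j)"

lemma arr_path_pos: "(arr xs)\<^sup>*\<^sup>* i j \<Longrightarrow> i = j \<or> pos xs i < pos xs j"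
  by (induction rule: rtranclp_induct) (auto simp: arr_def)

lemma arr_path_in: "(arr xs)\<^sup>*\<^sup>* i j \<Longrightarrow> j \<in> I \<Longrightarrow> i \<in> I"
  by (induction rule: converse_rtranclp_induct) (auto simp: arr_def adj_in)

text \<open>If two predecessors \<open>j\<close>, \<open>j'\<close> of \<open>i\<close> had a common ancestor, then a last one, \<open>k\<close>,
  would have two successors; with one successor of every other vertex between it and \<open>i\<close>
  this makes as many edges as vertices.\<close>

lemma ancestors_disjoint:
  assumes j: "arr xs j i" "arr xs j' i" "j \<noteq> j'" and k: "(arr xs)\<^sup>*\<^sup>* k j" "(arr xs)\<^sup>*\<^sup>* k j'"
  shows False
proof -
  let ?S = "{k. (arr xs)\<^sup>*\<^sup>* k j \<and> (arr xs)\<^sup>*\<^sup>* k j'}"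
  let ?A = "{k. (arr xs)\<^sup>*\<^sup>* k j \<or> (arr xs)\<^sup>*\<^sup>* k j'}"
  have I: "i \<in> I" "j \<in> I" "j' \<in> I" using j by (auto simp: arr_def adj_in)
  have AI: "?A \<subseteq> I" using arr_path_in I by blast
  have finA: "finite ?A" by (rule finite_subset[OF AI finite_I])
  have finS: "finite ?S" by (rule finite_subset[OF _ finA]) blast
  \<comment> \<open>\<open>k\<close> becomes a common ancestor of maximal position; a common
    ancestor after \<open>k\<close> is thereby excluded.\<close>
  define m where "m = Max (pos xs ` ?S)"
  have "m \<in> pos xs ` ?S" unfolding m_def using finS k by (intro Max_in) auto
  then obtain k where k: "k \<in> ?S" "pos xs k = m" by blast
  then have max: "pos xs l \<le> pos xs k" if "l \<in> ?S" for l
    using that finS unfolding m_def by (metis (no_types, lifting) Max_ge finite_imageI imageI)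
  have i_notin: "i \<notin> ?A"
    using j arr_path_pos by (fastforce simp: arr_def)
  \<comment> \<open>The first step of a path from \<open>m\<close> to \<open>t\<close>, prolonged by
    the arrow from \<open>t\<close> to \<open>i\<close>: it ends at \<open>i\<close> if the path is
    trivial and at an ancestor of \<open>t\<close> otherwise.\<close>
  have succ: "\<exists>l. arr xs m l \<and> (l = i \<and> m = t \<or> (arr xs)\<^sup>*\<^sup>* l t)" if "(arr xs)\<^sup>*\<^sup>* m t" "arr xs t i" for m t
    using that(1) by (cases rule: converse_rtranclpE) (use that(2) in auto)
  obtain l where l: "arr xs k l" "l = i \<and> k = j \<or> (arr xs)\<^sup>*\<^sup>* l j" using succ[of k j] k(1) j by blast
  obtain l' where l': "arr xs k l'" "l' = i \<and> k = j' \<or> (arr xs)\<^sup>*\<^sup>* l' j'" using succ[of k j'] k(1) j by blast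
  have "l \<noteq> l'"
  proof
    assume "l = l'"
    then have "l \<in> ?S" using l l' i_notin j(3) by auto
    then show False using max[of l] l(1) by (simp add: arr_def)
  qed
  have "\<exists>s. \<forall>m\<in>?A. arr xs m (s m) \<and> s m \<in> insert i ?A"
    by (rule bchoice) (use succ j in blast)
  then obtain s where s: "\<And>m. m \<in> ?A \<Longrightarrow> arr xs m (s m) \<and> s m \<in> insert i ?A" by blast
  \<comment> \<open>At least one of \<open>l\<close> and \<open>l'\<close> differs from the
    successor \<open>s k\<close> already chosen. It supplies the extra edge that brings the number
    of edges up to that of the vertices in \<open>insert i ?A\<close>.\<close>
  obtain l'' where l'': "arr xs k l''" "l'' \<in> insert i ?A" "l'' \<noteq> s k"
    using l l' \<open>l \<noteq> l'\<close> by (metis (mono_tags, lifting) insert_iff mem_Collect_eq)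
  let ?F = "insert (k, l'') ((\<lambda>m. (m, s m)) ` ?A)"
  have "card ?F < card (insert i ?A)"
  proof (rule card_edges_less)
    show "insert i ?A \<subseteq> I" using AI I by blast
    show "?F \<subseteq> insert i ?A \<times> insert i ?A" using s l'' k by blast
    show "adj m n" if "(m, n) \<in> ?F" for m n using that s l'' by (auto simp: arr_def)
    have "pos xs m < pos xs n" if "(m, n) \<in> ?F" for m n using that s l'' by (auto simp: arr_def)
    then show "(n, m) \<notin> ?F" if "(m, n) \<in> ?F" for m n using that by (meson less_asym)
  qed simp
  moreover have "card ((\<lambda>m. (m, s m)) ` ?A) = card ?A" by (intro card_image) (auto simp: inj_on_def)
  ultimately show False
    using finA i_notin l'' by (subst (asm) card_insert_disjoint) auto
qed

text \<open>The ancestors of \<open>i\<close> are \<open>i\<close> itself and the ancestors of its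
  predecessors. By \<open>ancestors_disjoint\<close> these sets do not overlap, so the sums add
  up.\<close>

lemma pathsum_rec:
  assumes "i \<in> I"
  shows "pathsum xs i = a i + (\<Sum>j\<in>{j \<in> I. arr xs j i}. pathsum xs j)"
proof -
  let ?D = "\<lambda>i. {j \<in> I. (arr xs)\<^sup>*\<^sup>* j i}" and ?P = "{j \<in> I. arr xs j i}"
  have D: "?D i = insert i (\<Union>j\<in>?P. ?D j)"
    using assms by (auto elim: rtranclp.cases intro: rtranclp.rtrancl_into_rtrancl simp: arr_def adj_in)
  have "i \<notin> (\<Union>j\<in>?P. ?D j)"
    using arr_path_pos by (fastforce simp: arr_def)
  moreover have "(\<Sum>k\<in>(\<Union>j\<in>?P. ?D j). a k) = (\<Sum>j\<in>?P. \<Sum>k\<in>?D j. a k)"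
    using finite_I ancestors_disjoint by (intro sum.UNION_disjoint) auto
  ultimately show ?thesis
    unfolding pathsum_def D using finite_I by (subst sum.insert) auto
qed

text \<open>Both sides satisfy the same recursion over predecessors, and these have smaller
  position.\<close>

lemma gam_eq_pathsum:
  assumes "distinct xs" "set xs = I" "i \<in> I"
  shows "gam xs i = pathsum xs i"
  using assms(3)
proof (induction "pos xs i" arbitrary: i rule: less_induct)
  case less
  have "gam xs i = a i + (\<Sum>j\<in>{j \<in> I. arr xs j i}. gam xs j)"
    using gam_rec[of xs i] assms less.prems by (simp add: arr_def)
  also have "(\<Sum>j\<in>{j \<in> I. arr xs j i}. gam xs j) = (\<Sum>j\<in>{j \<in> I. arr xs j i}. pathsum xs j)"
    by (rule sum.cong) (use less.hyps in \<open>auto simp: arr_def\<close>)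
  finally show ?case using pathsum_rec[OF less.prems] by simp
qed

text \<open>For the fundamental weight \<open>v\<close> dual to \<open>a i\<close>, the sum in
  \<open>cox_eq\<close> collapses to \<open>gam xs i\<close>. The order of quantifiers matters:
  \<open>v\<close> is chosen before the word \<open>xs\<close>.\<close>

lemma gam_dual:
  assumes i: "i \<in> I"
  obtains v where "\<And>xs. distinct xs \<Longrightarrow> set xs = I \<Longrightarrow> gam xs i = v - cox xs v"
proof -
  obtain v where "\<And>x. x \<in> a ` I \<Longrightarrow> x \<bullet> v = of_bool (x = a i)"
    using independent_dual_vector[OF indep_a, of "\<lambda>x. of_bool (x = a i)"] by blast
  then have v: "v \<bullet> a k = of_bool (k = i)" if "k \<in> I" for k
    using that inj_on_eq_iff[OF inj_a that i] by (simp add: inner_commute[of v])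
  have "gam xs i = v - cox xs v" if "distinct xs" "set xs = I" for xs
    using cox_eq[OF that(1), of v] that v i finite_I
    by (simp add: of_bool_def if_distrib[of "\<lambda>x. x *\<^sub>R _"] cong: if_cong sum.cong)
  then show thesis by (rule that)
qed

text \<open>The vectors \<open>gam xs i\<close>, and hence the sets of ancestors, depend on \<open>cox xs\<close> only.\<close>

lemma arr_unique:
  assumes xs: "distinct xs" "set xs = I" and ys: "distinct ys" "set ys = I"
    and eq: "cox xs = cox ys" and arr: "arr xs i j"
  shows "arr ys i j"
proof -
  have ij: "i \<in> I" "j \<in> I" "i \<noteq> j" using arr by (auto simp: arr_def adj_def)
  obtain v where "\<And>xs. distinct xs \<Longrightarrow> set xs = I \<Longrightarrow> gam xs i = v - cox xs v"
    using gam_dual[OF ij(1)] by blast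
  then have "gam xs i = gam ys i" using xs ys eq by simp
  then have "{k \<in> I. (arr xs)\<^sup>*\<^sup>* k i} = {k \<in> I. (arr ys)\<^sup>*\<^sup>* k i}"
    using gam_eq_pathsum xs ys ij by (intro subset_sum_inj) (auto simp: pathsum_def)
  \<comment> \<open>The word \<open>xs\<close> excludes \<open>j\<close> from the ancestors of
    \<open>i\<close>, hence so does \<open>ys\<close>; adjacency then leaves only the arrow from
    \<open>i\<close> to \<open>j\<close>.\<close>
  moreover have "\<not> (arr xs)\<^sup>*\<^sup>* j i"
    using arr arr_path_pos[of xs j i] by (auto simp: arr_def adj_in)
  ultimately have "\<not> arr ys j i" using ij by blast
  then show ?thesis
    using arr pos_inj[of i ys j] ys ij adj_sym by (auto simp: arr_def intro: linorder_neqE)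
qed

text \<open>The mesh relation for the \<beta> roots of one base. It compares two values of
  \<open>cox xs (a i)\<close>: the one from \<open>cox_eq\<close>, and the one obtained by solving
  \<open>gam_rec\<close> for \<open>a i\<close>.\<close>

lemma cox_gam:
  assumes xs: "distinct xs" "set xs = I" and i: "i \<in> I"
  shows "gam xs i + cox xs (gam xs i) =
    (\<Sum>j\<in>{j \<in> I. arr xs i j}. gam xs j) + (\<Sum>j\<in>{j \<in> I. arr xs j i}. cox xs (gam xs j))"
proof -
  let ?in = "{j \<in> I. arr xs j i}" and ?out = "{j \<in> I. arr xs i j}"
  have ai: "a i = gam xs i - (\<Sum>j\<in>?in. gam xs j)"
    using gam_rec[of xs i] assms by (simp add: arr_def)
  have "(\<Sum>j\<in>I. (a i \<bullet> a j) *\<^sub>R gam xs j) = 2 *\<^sub>R gam xs i + (\<Sum>j\<in>I - {i}. (a i \<bullet> a j) *\<^sub>R gam xs j)"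
    using finite_I i by (simp add: sum.remove[of I i] norm_two)
  also have "(\<Sum>j\<in>I - {i}. (a i \<bullet> a j) *\<^sub>R gam xs j) = (\<Sum>j\<in>?in \<union> ?out. - gam xs j)"
  proof (rule sum.mono_neutral_cong_right)
    show "\<forall>j\<in>I - {i} - (?in \<union> ?out). (a i \<bullet> a j) *\<^sub>R gam xs j = 0"
    proof
      fix j assume j: "j \<in> I - {i} - (?in \<union> ?out)"
      then have "pos xs i \<noteq> pos xs j" using pos_inj[of i xs j] assms by auto
      then have "\<not> adj i j" using j adj_sym[of i j] by (auto simp: arr_def)
      then have "a i \<bullet> a j = 0" using j i off_diag[of i j] by (auto simp: adj_def)
      then show "(a i \<bullet> a j) *\<^sub>R gam xs j = 0" by simp
    qed
  qed (use finite_I in \<open>auto simp: arr_def adj_def inner_commute\<close>)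
  also have "\<dots> = (\<Sum>j\<in>?in. - gam xs j) + (\<Sum>j\<in>?out. - gam xs j)"
  proof (rule sum.union_disjoint)
    show "?in \<inter> ?out = {}" by (force simp: arr_def)
  qed (use finite_I in simp_all)
  finally have "cox xs (a i) = a i - 2 *\<^sub>R gam xs i + (\<Sum>j\<in>?in. gam xs j) + (\<Sum>j\<in>?out. gam xs j)"
    using cox_eq[of xs "a i"] xs by (simp add: sum_negf)
  moreover have "cox xs (a i) = cox xs (gam xs i) - (\<Sum>j\<in>?in. cox xs (gam xs j))"
    by (subst ai) (simp add: linear_diff[OF linear_cox] linear_sum[OF linear_cox])
  ultimately show ?thesis
    unfolding ai by (simp add: algebra_simps scaleR_2)
qed

end


section \<open>The mesh lattice\<close>

lemma even_difference_mod:
  assumes "0 < h" "0 \<le> n" "n < 2 * int h" "even (n - m)"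
  obtains k :: nat where "(m + 2 * int k) mod (2 * int h) = n"
proof -
  obtain q where q: "n - m = 2 * q" using assms(4) by blast
  \<comment> \<open>Reducing \<open>q\<close> modulo \<open>h\<close> makes the number of steps
    nonnegative and changes \<open>2 * q\<close> only by a multiple of \<open>2 * h\<close>.\<close>
  have "(m + 2 * (q mod int h)) mod (2 * int h) = (m + (2 * q) mod (2 * int h)) mod (2 * int h)"
    by (simp add: mod_mult_mult1)
  also have "\<dots> = (m + (n - m)) mod (2 * int h)" unfolding q by (rule mod_add_right_eq)
  also have "\<dots> = n" using assms by simp
  finally show thesis
    using that[of "nat (q mod int h)"] assms(1) by simp
qed

locale mesh =
  fixes I :: "'i set" and E :: "'i \<Rightarrow> 'i \<Rightarrow> bool" and p :: "'i \<Rightarrow> int" and h :: nat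
  assumes finite_I: "finite I" and h_pos: "0 < h"
    and E_sym: "E i j \<Longrightarrow> E j i" and parity: "parity_function I E p"
begin

abbreviation "F \<equiv> free_Abelian_group (Ihat I p h)"
abbreviation "J \<equiv> mesh_subgroup I E p h"

lemma finite_Ihat: "finite (Ihat I p h)"
  by (rule finite_subset[of _ "I \<times> {0..<2 * int h}"]) (auto simp: Ihat_def finite_I)

lemma Ihat_shift:
  assumes "(i, n) \<in> Ihat I p h"
  shows "(i, (n + 2 * k) mod (2 * int h)) \<in> Ihat I p h"
    and "j \<in> I \<Longrightarrow> E i j \<Longrightarrow> (j, (n + 1) mod (2 * int h)) \<in> Ihat I p h"
proof -
  have par: "even (m mod (2 * int h)) = even m" for m
    by (simp add: dvd_mod_iff)
  have n: "i \<in> I" "even (p i + n)"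
    using assms by (auto simp: Ihat_def cong_0_iff)
  show "(i, (n + 2 * k) mod (2 * int h)) \<in> Ihat I p h"
    using n h_pos by (simp add: Ihat_def cong_0_iff par)
  assume j: "j \<in> I" "E i j"
  then have "[p i = p j + 1] (mod 2)"
    using parity n by (auto simp: parity_function_def)
  then have "even (p i - (p j + 1))" by (simp add: cong_iff_dvd_diff)
  then have "even (p j + (n + 1))" using n(2) by presburger
  then show "(j, (n + 1) mod (2 * int h)) \<in> Ihat I p h"
    using j h_pos by (simp add: Ihat_def cong_0_iff par)
qed

lemma mesh_relation_closed:
  assumes "x \<in> Ihat I p h"
  shows "mesh_relation I E h x \<in> carrier F"
proof -
  obtain i n where x: "x = (i, n)" by (cases x)
  let ?S = "\<Sum>j\<in>{j \<in> I. E i j}. frag_of (j, (n + 1) mod (2 * int h))"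
  have "?S \<in> carrier F"
    using Ihat_shift(2) assms x by (intro sum_closed_free_Abelian_group) simp
  then have "frag_of x - ?S \<in> carrier F"
    using assms by (simp add: order.trans[OF keys_diff])
  then have "frag_of x - ?S + frag_of (shift h 2 x) \<in> carrier F"
    using Ihat_shift(1)[of i n 1] assms x
    by (simp add: order.trans[OF keys_add] shift_def del: frag_of_in_free_Abelian_group)
  then show ?thesis by (simp add: mesh_relation_def x)
qed

lemma subgroup_J: "subgroup J F"
  unfolding mesh_subgroup_def
  using mesh_relation_closed by (intro group.generate_is_subgroup) auto

lemma J_carrier: "x \<in> J \<Longrightarrow> Poly_Mapping.keys x \<subseteq> Ihat I p h"
  using subgroup.mem_carrier[OF subgroup_J] by simp

lemma J_zero: "0 \<in> J"
  using subgroup.one_closed[OF subgroup_J] by simp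

lemma J_diff: "x \<in> J \<Longrightarrow> y \<in> J \<Longrightarrow> x - y \<in> J"
  using subgroup.m_closed[OF subgroup_J, of x "- y"] subgroup.m_inv_closed[OF subgroup_J, of y]
    J_carrier[of y] by simp

lemma mesh_relation_in_J: "x \<in> Ihat I p h \<Longrightarrow> mesh_relation I E h x \<in> J"
  unfolding mesh_subgroup_def by (intro generate.incl imageI)

text \<open>Acyclicity of the orientation with an arrow from \<open>j\<close> to \<open>i\<close>
  when \<eta> increases by 1. Since the values are residues, this is not automatic; the form with
  minimal elements suits a minimal-counterexample argument.\<close>

definition has_sources :: "('i \<Rightarrow> int) \<Rightarrow> bool" where
  "has_sources \<eta> \<longleftrightarrow> (\<forall>A\<subseteq>I. A \<noteq> {} \<longrightarrow>
     (\<exists>i\<in>A. \<forall>j\<in>A. \<not> (E i j \<and> [\<eta> i = \<eta> j + 1] (mod (2 * int h)))))"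

lemma height_in_Ihat:
  assumes "height_function I E p h \<eta>" "i \<in> I"
  shows "(i, \<eta> i) \<in> Ihat I p h"
proof -
  have "[\<eta> i = p i] (mod 2)" using assms by (auto simp: height_function_def)
  then have "even (\<eta> i - p i)" by (simp add: cong_iff_dvd_diff)
  then have "even (p i + \<eta> i)" by presburger
  then show ?thesis
    using assms by (auto simp: height_function_def Ihat_def cong_0_iff)
qed

text \<open>Going through the vertices from the sources on, the mesh relations express the slice
  \<open>\<eta> + 2\<close> by the slice \<open>\<eta>\<close>; repeating this reaches all of \<open>Ihat\<close>.\<close>

lemma slice_generates:
  assumes \<eta>: "height_function I E p h \<eta>" and src: "has_sources \<eta>"
    and JS: "J \<subseteq> S" and S: "\<And>x y. x \<in> S \<Longrightarrow> y \<in> S \<Longrightarrow> x - y \<in> S"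
    and slice: "\<And>i. i \<in> I \<Longrightarrow> frag_of (i, \<eta> i) \<in> S"
    and x: "x \<in> Ihat I p h"
  shows "frag_of x \<in> S"
proof -
  let ?m = "2 * int h"
  have S0: "0 \<in> S" using JS J_zero by blast
  have Sadd: "x + y \<in> S" if "x \<in> S" "y \<in> S" for x y
    using S[OF that(1) S[OF S0 that(2)]] by simp
  have Ssum: "sum g A \<in> S" if "\<And>a. a \<in> A \<Longrightarrow> g a \<in> S" for g and A :: "'i set"
    using that by (induction A rule: infinite_finite_induct) (auto intro: S0 Sadd)
  have step: "\<forall>i\<in>I. frag_of (i, (\<eta> i + 2 * int k) mod ?m) \<in> S" for k
  proof (induction k)
    case 0
    show ?case
    proof
      fix i assume "i \<in> I"
      then show "frag_of (i, (\<eta> i + 2 * int 0) mod ?m) \<in> S"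
        using \<eta> slice by (auto simp: height_function_def)
    qed
  next
    case (Suc k)
    \<comment> \<open>The vertices at which slice \<open>k + 1\<close> is not yet reached. A source
      \<open>i\<close> of this set has all its lower neighbours outside it.\<close>
    let ?A = "{i \<in> I. frag_of (i, (\<eta> i + 2 * int (Suc k)) mod ?m) \<notin> S}"
    show ?case
    proof (rule ccontr)
      assume "\<not> ?thesis"
      then have "?A \<noteq> {}" by blast
      moreover have "?A \<subseteq> I" by blast
      ultimately obtain i where i: "i \<in> ?A"
        and min: "\<And>j. j \<in> ?A \<Longrightarrow> \<not> (E i j \<and> [\<eta> i = \<eta> j + 1] (mod ?m))"
        using src unfolding has_sources_def by meson
      define n where "n = (\<eta> i + 2 * int k) mod ?m"
      have inI: "i \<in> I" using i by blast
      have n: "(i, n) \<in> Ihat I p h"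
        unfolding n_def by (rule Ihat_shift(1)) (rule height_in_Ihat[OF \<eta> inI])
      have n1: "(n + 1) mod ?m = (\<eta> i + 2 * int k + 1) mod ?m"
        unfolding n_def by (simp add: mod_add_left_eq)
      have "frag_of (j, (n + 1) mod ?m) \<in> S" if j: "j \<in> I" "E i j" for j
      proof -
        have "[\<eta> j = \<eta> i + 1] (mod ?m) \<or> [\<eta> j = \<eta> i - 1] (mod ?m)"
          using \<eta> inI j by (auto simp: height_function_def)
        then show ?thesis
        proof
          \<comment> \<open>A higher neighbour enters the relation at its own level
            \<open>k\<close>, covered by the induction hypothesis.\<close>
          assume "[\<eta> j = \<eta> i + 1] (mod ?m)"
          from cong_add[OF this cong_refl[of "2 * int k"]]
          have "(n + 1) mod ?m = (\<eta> j + 2 * int k) mod ?m"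
            unfolding n1 by (simp add: cong_def algebra_simps)
          then show ?thesis using Suc j(1) by simp
        next
          \<comment> \<open>A lower neighbour enters already at level \<open>k + 1\<close>, so it
            must lie outside \<open>?A\<close>.\<close>
          assume "[\<eta> j = \<eta> i - 1] (mod ?m)"
          from cong_add[OF this cong_refl[of 1]]
          have c: "[\<eta> i = \<eta> j + 1] (mod ?m)" by (simp add: cong_sym)
          from cong_add[OF this cong_refl[of "2 * int k + 1"]]
          have "(n + 1) mod ?m = (\<eta> j + 2 * int (Suc k)) mod ?m"
            unfolding n1 by (simp add: cong_def algebra_simps)
          moreover have "j \<notin> ?A" using min c j(2) by blast
          ultimately show ?thesis using j(1) by simp
        qed
      qed
      then have sum: "(\<Sum>j\<in>{j \<in> I. E i j}. frag_of (j, (n + 1) mod ?m)) \<in> S" (is "?s \<in> S")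
        by (intro Ssum) simp
      have "mesh_relation I E h (i, n) \<in> S"
        using mesh_relation_in_J[OF n] JS by blast
      then have "mesh_relation I E h (i, n) + ?s - frag_of (i, n) \<in> S"
        using Sadd S sum Suc inI n_def by blast
      also have "mesh_relation I E h (i, n) + ?s - frag_of (i, n) = frag_of (i, (n + 2) mod ?m)"
        by (simp add: mesh_relation_def shift_def)
      also have "(n + 2) mod ?m = (\<eta> i + 2 * int (Suc k)) mod ?m"
        unfolding n_def by (subst mod_add_left_eq) (simp add: algebra_simps)
      finally show False using i by blast
    qed
  qed
  obtain i n where in_: "x = (i, n)" by (cases x)
  have i: "i \<in> I" "0 \<le> n" "n < ?m" "even (p i + n)"
    using x in_ by (auto simp: Ihat_def cong_0_iff)
  have "even (p i + \<eta> i)" using height_in_Ihat[OF \<eta> i(1)] by (auto simp: Ihat_def cong_0_iff)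
  then have "even (n - \<eta> i)" using i(4) by presburger
  then obtain k where "(\<eta> i + 2 * int k) mod ?m = n"
    using even_difference_mod h_pos i by blast
  then show ?thesis using step[of k] i(1) in_ by auto
qed

definition slice_comb :: "('i \<Rightarrow> int) \<Rightarrow> ('i \<Rightarrow> int) \<Rightarrow> 'i \<times> int \<Rightarrow>\<^sub>0 int" where
  "slice_comb \<eta> d = (\<Sum>i\<in>I. frag_cmul (d i) (frag_of (i, \<eta> i)))"

lemma slice_comb_carrier:
  assumes "height_function I E p h \<eta>"
  shows "slice_comb \<eta> d \<in> carrier F"
  unfolding slice_comb_def
  using height_in_Ihat[OF assms] by (intro sum_closed_free_Abelian_group) auto

text \<open>The elements congruent modulo \<open>J\<close> to a combination of the slice form a
  subgroup containing \<open>J\<close> and the slice, so \<open>slice_generates\<close> puts every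
  generator in it.\<close>

lemma slice_spans:
  assumes \<eta>: "height_function I E p h \<eta>" and src: "has_sources \<eta>"
    and "Poly_Mapping.keys c \<subseteq> Ihat I p h"
  shows "\<exists>d. c - slice_comb \<eta> d \<in> J"
proof -
  let ?S = "{c. \<exists>d. c - slice_comb \<eta> d \<in> J}"
  have 0: "slice_comb \<eta> (\<lambda>_. 0) = 0" by (simp add: slice_comb_def)
  have JS: "J \<subseteq> ?S"
  proof
    fix x assume "x \<in> J"
    then show "x \<in> ?S" by (intro CollectI exI[of _ "\<lambda>_. 0"]) (simp add: 0)
  qed
  have S: "x - y \<in> ?S" if "x \<in> ?S" "y \<in> ?S" for x y
  proof -
    obtain d e where de: "x - slice_comb \<eta> d \<in> J" "y - slice_comb \<eta> e \<in> J" using \<open>x \<in> ?S\<close> \<open>y \<in> ?S\<close> by blast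
    have "slice_comb \<eta> (\<lambda>i. d i - e i) = slice_comb \<eta> d - slice_comb \<eta> e"
      by (simp add: slice_comb_def frag_cmul_diff_distrib sum_subtractf)
    then have "x - y - slice_comb \<eta> (\<lambda>i. d i - e i) = (x - slice_comb \<eta> d) - (y - slice_comb \<eta> e)"
      by simp
    then have "x - y - slice_comb \<eta> (\<lambda>i. d i - e i) \<in> J" using J_diff[OF de] by (simp only:)
    then show ?thesis by blast
  qed
  have slice: "frag_of (i, \<eta> i) \<in> ?S" if "i \<in> I" for i
  proof -
    have "slice_comb \<eta> (\<lambda>j. if j = i then 1 else 0) =
        (\<Sum>j\<in>I. if j = i then frag_of (j, \<eta> j) else 0)"
      unfolding slice_comb_def by (rule sum.cong) auto
    also have "\<dots> = frag_of (i, \<eta> i)" using finite_I that by simp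
    finally show ?thesis using J_zero
      by (intro CollectI exI[of _ "\<lambda>j. if j = i then 1 else 0"]) simp
  qed
  have "c \<in> ?S"
    using assms(3)
  proof (rule free_Abelian_group_induct)
    show "0 \<in> ?S" using JS J_zero by blast
    show "x - y \<in> ?S" if "x \<in> ?S" "y \<in> ?S" for x y using S that .
    show "frag_of x \<in> ?S" if "x \<in> Ihat I p h" for x
      using slice_generates[OF \<eta> src JS S slice that] .
  qed
  then show ?thesis by blast
qed

end

section \<open>Evaluation of the mesh group in a real vector space\<close>

locale mesh_vectors = mesh I E p h
  for I :: "'i set" and E :: "'i \<Rightarrow> 'i \<Rightarrow> bool" and p :: "'i \<Rightarrow> int" and h :: nat +
  fixes \<psi> :: "'i \<times> int \<Rightarrow> 'a::real_vector"
  assumes mesh_zero: "(i, n) \<in> Ihat I p h \<Longrightarrow>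
      \<psi> (i, n) - (\<Sum>j\<in>{j \<in> I. E i j}. \<psi> (j, (n + 1) mod (2 * int h))) + \<psi> (shift h 2 (i, n)) = 0"
begin

text \<open>The additive extension of \<psi>. Summing over all of \<open>Ihat\<close> instead of the
  support of \<open>c\<close> keeps the index set fixed, so that additivity is immediate.\<close>

definition ev :: "('i \<times> int \<Rightarrow>\<^sub>0 int) \<Rightarrow> 'a" where
  "ev c = (\<Sum>x\<in>Ihat I p h. of_int (Poly_Mapping.lookup c x) *\<^sub>R \<psi> x)"

lemma ev_add: "ev (x + y) = ev x + ev y"
  by (simp add: ev_def lookup_add scaleR_left_distrib sum.distrib)

lemma ev_zero: "ev 0 = 0"
  by (simp add: ev_def)

lemma ev_minus: "ev (- x) = - ev x"
  using ev_add[of x "- x"] by (simp add: ev_zero eq_neg_iff_add_eq_0 add.commute)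

lemma ev_diff: "ev (x - y) = ev x - ev y"
  using ev_add[of x "- y"] by (simp add: ev_minus)

lemma ev_sum: "ev (sum g A) = (\<Sum>a\<in>A. ev (g a))"
  by (induction A rule: infinite_finite_induct) (simp_all add: ev_zero ev_add)

lemma ev_cmul: "ev (frag_cmul k c) = of_int k *\<^sub>R ev c"
  by (simp add: ev_def scaleR_sum_right)

lemma ev_frag_of:
  assumes "x \<in> Ihat I p h"
  shows "ev (frag_of x) = \<psi> x"
proof -
  have "ev (frag_of x) = (\<Sum>y\<in>Ihat I p h. if y = x then \<psi> y else 0)"
    unfolding ev_def by (rule sum.cong) auto
  then show ?thesis using assms finite_Ihat by simp
qed

lemma ev_mesh_relation:
  assumes "x \<in> Ihat I p h"
  shows "ev (mesh_relation I E h x) = 0"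
proof -
  obtain i n where x: "x = (i, n)" by (cases x)
  have "ev (mesh_relation I E h x) =
      \<psi> (i, n) - (\<Sum>j\<in>{j \<in> I. E i j}. \<psi> (j, (n + 1) mod (2 * int h))) + \<psi> (shift h 2 (i, n))"
    using assms Ihat_shift[of i n] Ihat_shift(1)[of i n 1] x
    by (simp add: mesh_relation_def ev_add ev_diff ev_sum ev_frag_of shift_def)
  then show ?thesis using mesh_zero assms x by simp
qed

lemma ev_J: "c \<in> J \<Longrightarrow> ev c = 0"
  unfolding mesh_subgroup_def
proof (induction rule: generate.induct)
  case (inv x)
  then have "inv\<^bsub>F\<^esub> x = - x" using mesh_relation_closed by auto
  then show ?case using inv ev_mesh_relation by (auto simp: ev_minus)
qed (auto simp: ev_zero ev_add ev_mesh_relation)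

lemma ev_slice_comb:
  assumes "height_function I E p h \<eta>"
  shows "ev (slice_comb \<eta> d) = (\<Sum>i\<in>I. of_int (d i) *\<^sub>R \<psi> (i, \<eta> i))"
  unfolding slice_comb_def
  using height_in_Ihat[OF assms] by (simp add: ev_sum ev_cmul ev_frag_of cong: sum.cong)

text \<open>Evaluation turns \<open>slice_spans\<close> into a statement about real spans. It does
  not presuppose independence of the slice, which is deduced from it by counting dimensions.\<close>

lemma slice_span_vectors:
  assumes \<eta>: "height_function I E p h \<eta>" "has_sources \<eta>" and x: "x \<in> Ihat I p h"
  shows "\<psi> x \<in> span ((\<lambda>i. \<psi> (i, \<eta> i)) ` I)"
proof -
  obtain d where d: "frag_of x - slice_comb \<eta> d \<in> J"
    using slice_spans[OF \<eta>, of "frag_of x"] x by auto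
  then have "\<psi> x = (\<Sum>i\<in>I. of_int (d i) *\<^sub>R \<psi> (i, \<eta> i))"
    using ev_J[OF d] x by (simp add: ev_diff ev_frag_of ev_slice_comb[OF \<eta>(1)])
  then show ?thesis
    by (simp add: span_sum span_scale span_base)
qed

end

section \<open>The quotient group, its slice bases and the isomorphism\<close>

locale mesh_realization = mesh_vectors I E p h \<psi>
  for I :: "'i set" and E :: "'i \<Rightarrow> 'i \<Rightarrow> bool" and p :: "'i \<Rightarrow> int" and h :: nat
    and \<psi> :: "'i \<times> int \<Rightarrow> 'a::real_vector" +
  assumes sources: "height_function I E p h \<eta> \<Longrightarrow> has_sources \<eta>"
    and slice_independent: "height_function I E p h \<eta> \<Longrightarrow>
      (\<Sum>i\<in>I. of_int (d i) *\<^sub>R \<psi> (i, \<eta> i)) = 0 \<Longrightarrow> i \<in> I \<Longrightarrow> d i = (0 :: int)"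
    and height_exists: "\<exists>\<eta>. height_function I E p h \<eta>"
begin

text \<open>Modulo \<open>J\<close> the element \<open>c\<close> is a slice combination; it
  evaluates to zero, so independence makes its coefficients vanish.\<close>

lemma ev_kernel:
  assumes "Poly_Mapping.keys c \<subseteq> Ihat I p h" "ev c = 0"
  shows "c \<in> J"
proof -
  obtain \<eta> where \<eta>: "height_function I E p h \<eta>" using height_exists by blast
  obtain d where d: "c - slice_comb \<eta> d \<in> J"
    using slice_spans[OF \<eta> sources[OF \<eta>] assms(1)] by blast
  then have "ev (slice_comb \<eta> d) = 0"
    using ev_J[OF d] assms(2) by (simp add: ev_diff)
  then have "d i = 0" if "i \<in> I" for i
    using slice_independent[OF \<eta> _ that] by (simp add: ev_slice_comb[OF \<eta>])
  then have "slice_comb \<eta> d = 0" by (simp add: slice_comb_def)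
  then show ?thesis using d by simp
qed

lemma comm_group_F: "comm_group F"
  by (rule abelian_free_Abelian_group)

lemma normal_J: "J \<lhd> F"
  using comm_group.subgroup_imp_normal[OF comm_group_F subgroup_J] .

abbreviation "Q \<equiv> mesh_lattice I E p h"

lemma comm_group_Q: "comm_group Q"
  unfolding mesh_lattice_def by (rule comm_group.abelian_FactGroup[OF comm_group_F subgroup_J])

lemma group_Q: "group Q"
  using comm_group_Q by (simp add: comm_group_def)

lemma class_hom: "(\<lambda>c. J #>\<^bsub>F\<^esub> c) \<in> hom F Q"
  unfolding mesh_lattice_def by (rule normal.r_coset_hom_Mod[OF normal_J])

lemma carrier_Q: "carrier Q = (\<lambda>c. J #>\<^bsub>F\<^esub> c) ` carrier F"
  by (auto simp: mesh_lattice_def FactGroup_def RCOSETS_def)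

lemma class_eq_one_iff: "c \<in> carrier F \<Longrightarrow> J #>\<^bsub>F\<^esub> c = \<one>\<^bsub>Q\<^esub> \<longleftrightarrow> c \<in> J"
  using group.coset_join1[OF group_free_Abelian_group _ _ subgroup_J]
    group.coset_join2[OF group_free_Abelian_group _ subgroup_J]
  by (auto simp: mesh_lattice_def FactGroup_def simp del: carrier_free_Abelian_group_iff)

text \<open>The dictionary between additive combinations in the free group and the multiplicative
  notation of the quotient used by \<open>int_basis\<close>.\<close>

lemma class_slice_comb:
  assumes \<eta>: "height_function I E p h \<eta>"
  shows "J #>\<^bsub>F\<^esub> slice_comb \<eta> d = finprod Q (\<lambda>i. mesh_class I E p h (i, \<eta> i) [^]\<^bsub>Q\<^esub> d i) I"
proof -
  interpret Q: comm_group Q by (rule comm_group_Q)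
  have cl: "mesh_class I E p h (i, \<eta> i) \<in> carrier Q" if "i \<in> I" for i
    using height_in_Ihat[OF \<eta> that] carrier_Q by (auto simp: mesh_class_def)
  have "J #>\<^bsub>F\<^esub> (\<Sum>i\<in>A. frag_cmul (d i) (frag_of (i, \<eta> i))) =
      finprod Q (\<lambda>i. mesh_class I E p h (i, \<eta> i) [^]\<^bsub>Q\<^esub> d i) A" if "A \<subseteq> I" for A
    using finite_subset[OF that finite_I] that
  proof (induction A rule: finite_induct)
    case empty
    then show ?case using class_eq_one_iff[of 0] J_zero by simp
  next
    case (insert i A)
    let ?x = "frag_of (i, \<eta> i)" and ?s = "\<Sum>i\<in>A. frag_cmul (d i) (frag_of (i, \<eta> i))"
    have x: "?x \<in> carrier F" "frag_cmul (d i) ?x \<in> carrier F"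
      using height_in_Ihat[OF \<eta>] insert.prems by auto
    have s: "?s \<in> carrier F"
      using height_in_Ihat[OF \<eta>] insert.prems by (intro sum_closed_free_Abelian_group) auto
    have "J #>\<^bsub>F\<^esub> (frag_cmul (d i) ?x + ?s) = (J #>\<^bsub>F\<^esub> frag_cmul (d i) ?x) \<otimes>\<^bsub>Q\<^esub> (J #>\<^bsub>F\<^esub> ?s)"
      using hom_mult[OF class_hom x(2) s] by simp
    moreover have "J #>\<^bsub>F\<^esub> frag_cmul (d i) ?x = mesh_class I E p h (i, \<eta> i) [^]\<^bsub>Q\<^esub> d i"
      using hom_int_pow[OF class_hom x(1) group_free_Abelian_group group_Q, of "d i"] x(1)
      by (simp add: mesh_class_def)
    ultimately show ?case
      using insert cl by (simp add: Q.finprod_insert Pi_iff subset_iff)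
  qed
  then show ?thesis by (simp add: slice_comb_def)
qed

text \<open>Generation is \<open>slice_spans\<close> read in the quotient. A relation among the
  classes lifts to an element of \<open>J\<close>, which evaluates to a linear relation among
  independent vectors.\<close>

theorem slice_basis:
  assumes \<eta>: "height_function I E p h \<eta>"
  shows "int_basis Q I (\<lambda>i. mesh_class I E p h (i, \<eta> i))"
proof -
  interpret Q: comm_group Q by (rule comm_group_Q)
  let ?x = "\<lambda>i. mesh_class I E p h (i, \<eta> i)"
  have cl: "?x i \<in> carrier Q" if "i \<in> I" for i
    using height_in_Ihat[OF \<eta> that] carrier_Q by (auto simp: mesh_class_def)
  let ?K = "generate Q (?x ` I)"
  have K: "subgroup ?K Q" using cl by (intro Q.generate_is_subgroup) auto
  have prod_K: "finprod Q (\<lambda>i. ?x i [^]\<^bsub>Q\<^esub> d i) A \<in> ?K" if "A \<subseteq> I" for d :: "'i \<Rightarrow> int" and A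
    using finite_subset[OF that finite_I] that
  proof (induction A rule: finite_induct)
    case empty
    then show ?case using subgroup.one_closed[OF K] by simp
  next
    case (insert i A)
    have "?x i \<in> ?K" using insert.prems by (auto intro: generate.incl)
    then have "?x i [^]\<^bsub>Q\<^esub> d i \<in> ?K" using Q.subgroup_int_pow_closed[OF K] by blast
    then show ?case
      using insert cl subgroup.m_closed[OF K] by (simp add: Q.finprod_insert Pi_iff subset_iff)
  qed
  have "carrier Q \<subseteq> ?K"
  proof
    fix X assume "X \<in> carrier Q"
    then obtain c where c: "c \<in> carrier F" "X = J #>\<^bsub>F\<^esub> c" using carrier_Q by blast
    obtain d where d: "c - slice_comb \<eta> d \<in> J"
      using slice_spans[OF \<eta> sources[OF \<eta>]] c(1) by auto
    have dF: "c - slice_comb \<eta> d \<in> carrier F" using J_carrier[OF d] by simp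
    have "X = J #>\<^bsub>F\<^esub> ((c - slice_comb \<eta> d) + slice_comb \<eta> d)" using c by simp
    also have "\<dots> = (J #>\<^bsub>F\<^esub> (c - slice_comb \<eta> d)) \<otimes>\<^bsub>Q\<^esub> (J #>\<^bsub>F\<^esub> slice_comb \<eta> d)"
      using hom_mult[OF class_hom dF slice_comb_carrier[OF \<eta>, of d]]
      by (simp only: mult_free_Abelian_group)
    also have "J #>\<^bsub>F\<^esub> (c - slice_comb \<eta> d) = \<one>\<^bsub>Q\<^esub>"
      using class_eq_one_iff[OF dF] d by simp
    finally have "X = J #>\<^bsub>F\<^esub> slice_comb \<eta> d"
      using carrier_Q slice_comb_carrier[OF \<eta>] by simp
    then show "X \<in> ?K" using prod_K[of I d] class_slice_comb[OF \<eta>] by simp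
  qed
  moreover have "?K \<subseteq> carrier Q" using K by (rule subgroup.subset)
  moreover have "d i = 0"
    if "finprod Q (\<lambda>i. ?x i [^]\<^bsub>Q\<^esub> d i) I = \<one>\<^bsub>Q\<^esub>" "i \<in> I" for d :: "'i \<Rightarrow> int" and i
  proof -
    have "slice_comb \<eta> d \<in> J"
      using that(1) class_slice_comb[OF \<eta>, of d] class_eq_one_iff slice_comb_carrier[OF \<eta>] by metis
    then have "(\<Sum>i\<in>I. of_int (d i) *\<^sub>R \<psi> (i, \<eta> i)) = 0"
      using ev_J ev_slice_comb[OF \<eta>] by metis
    then show ?thesis using slice_independent[OF \<eta> _ that(2)] by blast
  qed
  ultimately show ?thesis
    using cl finite_I unfolding int_basis_def by blast
qed

text \<open>The first isomorphism theorem for \<open>ev\<close>, whose kernel is \<open>J\<close>;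
  the induced map goes from \<open>Q\<close> to \<open>H\<close> and is inverted.\<close>

theorem lattice_iso:
  assumes H: "group H" "monoid.mult H = (+)"
    and carr: "carrier H = ev ` carrier F"
  shows "\<exists>f \<in> iso H Q. \<forall>x\<in>Ihat I p h. f (\<psi> x) = mesh_class I E p h x"
proof -
  interpret group_hom F H ev
    by (intro group_hom.intro group_hom_axioms.intro homI H group_free_Abelian_group)
      (use H carr ev_add in auto)
  have one: "\<one>\<^bsub>H\<^esub> = 0" using hom_one by (simp add: ev_zero)
  have "kernel F H ev = J"
    using ev_kernel ev_J J_carrier by (auto simp: kernel_def one)
  then have g: "(\<lambda>X. the_elem (ev ` X)) \<in> iso Q H"
    using FactGroup_iso_set carr by (simp add: mesh_lattice_def)
  let ?f = "inv_into (carrier Q) (\<lambda>X. the_elem (ev ` X))"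
  have "?f \<in> iso H Q" using group.iso_set_sym[OF group_Q g] .
  moreover have "?f (\<psi> x) = mesh_class I E p h x" if x: "x \<in> Ihat I p h" for x
  proof -
    \<comment> \<open>\<open>ev\<close> is constant on a coset of its kernel, so
      \<open>the_elem\<close> extracts a well-defined value.\<close>
    have "ev ` mesh_class I E p h x = {\<psi> x}"
      using ev_J J_zero x by (force simp: mesh_class_def r_coset_def ev_add ev_frag_of)
    then have "the_elem (ev ` mesh_class I E p h x) = \<psi> x" by simp
    moreover have "mesh_class I E p h x \<in> carrier Q"
      using x carrier_Q by (auto simp: mesh_class_def)
    moreover have "inj_on (\<lambda>X. the_elem (ev ` X)) (carrier Q)"
      using g by (auto simp: iso_def bij_betw_def)
    ultimately show ?thesis by (metis (no_types, lifting) inv_into_f_f)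
  qed
  ultimately show ?thesis by blast
qed

end


section \<open>The identification of roots\<close>

lemma weyl_group_foldr:
  "set as \<subseteq> R \<Longrightarrow> foldr (\<circ>) (map reflection as) id \<in> weyl_group R"
  by (induction as) (auto intro: weyl_group.intros)

lemma simple_roots_labelled:
  assumes R: "root_system R" and two: "simply_laced_normalized R"
    and lab: "simple_root_labelling R I \<alpha>" and P: "simple_roots R P"
  shows "simply_laced_base I (\<alpha> P)"
proof -
  have bij: "bij_betw (\<alpha> P) I P" using lab P by (auto simp: simple_root_labelling_def)
  then have inj: "inj_on (\<alpha> P) I" and im: "\<alpha> P ` I = P" by (auto simp: bij_betw_def)
  have PR: "P \<subseteq> R" "independent P" using P by (auto simp: simple_roots_def)
  have two': "\<And>a. a \<in> R \<Longrightarrow> a \<bullet> a = 2" using two by (auto simp: simply_laced_normalized_def)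
  show ?thesis
  proof
    show "\<alpha> P i \<bullet> \<alpha> P i = 2" if "i \<in> I" for i using that im PR two' by blast
    show "\<alpha> P i \<bullet> \<alpha> P j = 0 \<or> \<alpha> P i \<bullet> \<alpha> P j = -1" if "i \<in> I" "j \<in> I" "i \<noteq> j" for i j
      using simple_roots_inner[OF R two' P, of "\<alpha> P i" "\<alpha> P j"] that im inj
      by (auto simp: inj_on_def)
  qed (use inj im PR in auto)
qed

text \<open>The existential quantifier over bases can be replaced by any given base: the Weyl group
  moves one base to another, respects the labelling and preserves inner products.\<close>

lemma dynkin_edge_iff:
  assumes R: "root_system R" and two: "simply_laced_normalized R"
    and lab: "simple_root_labelling R I \<alpha>" and P: "simple_roots R P"
  shows "dynkin_edge R I \<alpha> i j \<longleftrightarrow> i \<in> I \<and> j \<in> I \<and> i \<noteq> j \<and> \<alpha> P i \<bullet> \<alpha> P j = -1"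
proof -
  have two': "\<And>a. a \<in> R \<Longrightarrow> a \<bullet> a = 2" using two by (auto simp: simply_laced_normalized_def)
  have indep: "\<alpha> Q i \<bullet> \<alpha> Q j = \<alpha> P i \<bullet> \<alpha> P j" if Q: "simple_roots R Q" and ij: "i \<in> I" "j \<in> I" for Q
  proof -
    obtain w where w: "w \<in> weyl_group R" "w ` Q = P"
      using weyl_group_transitive_on_bases[OF R two' P Q] by blast
    then have "w (\<alpha> Q i) = \<alpha> P i" "w (\<alpha> Q j) = \<alpha> P j"
      using lab Q ij unfolding simple_root_labelling_def by metis+
    then show ?thesis using weyl_group_inner[OF w(1)] by metis
  qed
  show ?thesis
  proof
    assume "dynkin_edge R I \<alpha> i j"
    then obtain Q where "i \<in> I" "j \<in> I" "i \<noteq> j" "simple_roots R Q" "- (\<alpha> Q i \<bullet> \<alpha> Q j) = 1"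
      unfolding dynkin_edge_def by blast
    then show "i \<in> I \<and> j \<in> I \<and> i \<noteq> j \<and> \<alpha> P i \<bullet> \<alpha> P j = -1"
      using indep[of Q] by simp
  qed (use P in \<open>auto simp: dynkin_edge_def\<close>)
qed

lemma group_root_lattice: "group (root_lattice R)"
proof (rule groupI)
  fix x y assume "x \<in> carrier (root_lattice R)" "y \<in> carrier (root_lattice R)"
  then obtain c d :: "'a \<Rightarrow> int" where "x = (\<Sum>a\<in>R. of_int (c a) *\<^sub>R a)" "y = (\<Sum>a\<in>R. of_int (d a) *\<^sub>R a)"
    by (auto simp: root_lattice_def)
  then have "x + y = (\<Sum>a\<in>R. of_int (c a + d a) *\<^sub>R a)"
    by (simp add: scaleR_left_distrib sum.distrib)
  then show "x \<otimes>\<^bsub>root_lattice R\<^esub> y \<in> carrier (root_lattice R)"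
    unfolding root_lattice_def by (auto intro!: exI[of _ "\<lambda>a. c a + d a"])
next
  show "\<one>\<^bsub>root_lattice R\<^esub> \<in> carrier (root_lattice R)"
    by (auto simp: root_lattice_def intro!: exI[of _ "\<lambda>a. 0"])
next
  fix x assume "x \<in> carrier (root_lattice R)"
  then obtain c :: "'a \<Rightarrow> int" where "x = (\<Sum>a\<in>R. of_int (c a) *\<^sub>R a)"
    by (auto simp: root_lattice_def)
  then have "- x = (\<Sum>a\<in>R. of_int (- c a) *\<^sub>R a)" by (simp add: sum_negf)
  then have "- x \<in> carrier (root_lattice R)"
    unfolding root_lattice_def by (auto intro!: exI[of _ "\<lambda>a. - c a"])
  then show "\<exists>y\<in>carrier (root_lattice R). y \<otimes>\<^bsub>root_lattice R\<^esub> x = \<one>\<^bsub>root_lattice R\<^esub>"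
    by (intro bexI[of _ "- x"]) (simp_all add: root_lattice_def)
qed (simp_all add: root_lattice_def add.assoc)

theorem theorem6p1:
  fixes R :: "'a::euclidean_space set"
    and I :: "'i set"
    and \<alpha> :: "'a set \<Rightarrow> 'i \<Rightarrow> 'a"
    and C :: "'a \<Rightarrow> 'a"
    and E :: "'i \<Rightarrow> 'i \<Rightarrow> bool"
    and h :: nat
    and p :: "'i \<Rightarrow> int"
    and i0 :: 'i
    and \<Phi>0 \<Phi> :: "'a \<Rightarrow> 'i \<times> int"
  assumes "root_system R" and "reduced_roots R" and "irreducible_roots R"
    and "simply_laced_normalized R"
    and "simple_root_labelling R I \<alpha>"
    and "coxeter_element R C"
    and E_eq: "E = dynkin_edge R I \<alpha>"
    and h_eq: "h = coxeter_number C"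
    and "parity_function I E p"
    and "i0 \<in> I"
    and "base_identification R I \<alpha> C p i0 \<Phi>0"
    and "root_identification R I \<alpha> C p i0 \<Phi>0 \<Phi>"
  shows "(\<exists>f \<in> iso (root_lattice R) (mesh_lattice I E p h).
            \<forall>a\<in>R. f a = mesh_class I E p h (\<Phi> a)) \<and>
         (\<forall>\<eta>. height_function I E p h \<eta> \<longrightarrow>
            int_basis (mesh_lattice I E p h) I (\<lambda>i. mesh_class I E p h (i, \<eta> i)))"
proof -
  note R = assms(1)
  have finR: "finite R" and R0: "0 \<notin> R" and spanR: "span R = UNIV"
    using R by (auto simp: root_system_def)
  obtain P as where P: "simple_roots R P" and as: "distinct as" "set as = P"
    and C_as: "C = foldr (\<circ>) (map reflection as) id"
    using assms(6) by (auto simp: coxeter_element_def)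
  have PR: "P \<subseteq> R" "independent P" "span P = UNIV" using P by (auto simp: simple_roots_def)
  interpret B: simply_laced_base I "\<alpha> P"
    by (rule simple_roots_labelled[OF R assms(4,5) P])
  have bij: "bij_betw (\<alpha> P) I P" using assms(5) P by (auto simp: simple_root_labelling_def)
  have im: "\<alpha> P ` I = P" using bij by (simp add: bij_betw_def)
  have E: "E = B.adj"
    unfolding E_eq using dynkin_edge_iff[OF R assms(4,5) P] by (intro ext) (simp add: B.adj_def)

  \<comment> \<open>The ordering of simple roots that defines the Coxeter element is pulled back to
    an ordering of \<open>I\<close>, which shows that \<open>P\<close> is compatible with
    \<open>C\<close>.\<close>
  define xs where "xs = map (the_inv_into I (\<alpha> P)) as"
  have map_xs: "map (\<alpha> P) xs = as"
    unfolding xs_def by (auto intro!: map_idI simp: f_the_inv_into_f_bij_betw[OF bij] as)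
  have inj_inv: "bij_betw (the_inv_into I (\<alpha> P)) P I" by (rule bij_betw_the_inv_into[OF bij])
  have xs: "distinct xs" "set xs = I"
    unfolding xs_def using as inj_inv by (auto simp: distinct_map bij_betw_def)
  have C: "C = B.cox xs"
    unfolding C_as B.cox_def map_xs[symmetric] by (simp add: comp_def)
  have expr: "coxeter_expression I \<alpha> C P ys \<longleftrightarrow> distinct ys \<and> set ys = I \<and> B.cox xs = B.cox ys" for ys
    unfolding coxeter_expression_def C B.cox_def by simp
  have compat: "compatible_base R I \<alpha> C P"
    unfolding compatible_base_def using P expr xs by blast
  \<comment> \<open>\<open>arrow\<close> allows any expression for \<open>C\<close>; by
    \<open>arr_unique\<close> all of them induce the orientation of \<open>xs\<close>.\<close>
  have arrow: "arrow R I \<alpha> C P = B.arr xs"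
  proof (intro ext iffI)
    fix i j assume "arrow R I \<alpha> C P i j"
    then obtain ys k l where ys: "B.adj i j" "coxeter_expression I \<alpha> C P ys"
      "k < l" "l < length ys" "ys ! k = i" "ys ! l = j"
      using E E_eq by (auto simp: arrow_def)
    then have d: "distinct ys" "set ys = I" "B.cox ys = B.cox xs" using expr by auto
    have "B.pos ys i = k" "B.pos ys j = l" using ys B.pos_nth[OF d(1)] by auto
    then have "B.arr ys i j" using ys by (simp add: B.arr_def)
    then show "B.arr xs i j" using B.arr_unique[OF d(1,2) xs d(3)] by blast
  next
    fix i j assume arr: "B.arr xs i j"
    then have "i \<in> set xs" "j \<in> set xs" using xs B.adj_in by (auto simp: B.arr_def)
    then have "B.pos xs i < B.pos xs j" "B.pos xs j < length xs" "xs ! B.pos xs i = i" "xs ! B.pos xs j = j"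
      using arr B.pos_less B.nth_pos by (auto simp: B.arr_def)
    moreover have "coxeter_expression I \<alpha> C P xs" using expr xs by blast
    moreover have "dynkin_edge R I \<alpha> i j" using arr E E_eq by (auto simp: B.arr_def)
    ultimately show "arrow R I \<alpha> C P i j" unfolding arrow_def by blast
  qed
  define g where "g = B.gam xs"
  have beta: "beta R I \<alpha> C P i = g i" if "i \<in> I" for i
    unfolding beta_def arrow g_def B.gam_eq_pathsum[OF xs that] B.pathsum_def ..

  have cox_weyl: "B.cox ys \<in> weyl_group R" if "set ys \<subseteq> I" for ys
  proof -
    have "B.cox ys = foldr (\<circ>) (map reflection (map (\<alpha> P) ys)) id"
      by (simp add: B.cox_def comp_def)
    moreover have "set (map (\<alpha> P) ys) \<subseteq> R" using that im PR by auto
    ultimately show ?thesis using weyl_group_foldr by metis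
  qed
  have CW: "C \<in> weyl_group R" using cox_weyl[of xs] xs C by simp
  have CR: "C b \<in> R" if "b \<in> R" for b using weyl_group_image[OF R CW] that by blast
  have CkR: "(C ^^ k) b \<in> R" if "b \<in> R" for b k using that CR by (induction k) auto
  have gR: "g i \<in> R" if "i \<in> I" for i
  proof -
    have "set (take (B.pos xs i) xs) \<subseteq> I" using set_take_subset xs(2) by fast
    then have "B.cox (take (B.pos xs i) xs) ` R = R" using weyl_group_image[OF R] cox_weyl by blast
    moreover have "\<alpha> P i \<in> R" using im PR that by blast
    ultimately show ?thesis unfolding g_def B.gam_def by blast
  qed

  have "\<exists>n. 0 < n \<and> C ^^ n = id" using weyl_group_finite_order[OF R CW] by blast
  then have h: "0 < h" "C ^^ h = id"
    unfolding h_eq coxeter_number_def by (metis (mono_tags, lifting) LeastI_ex)+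
  \<comment> \<open>If \<open>C\<close> were the identity, \<open>gam_dual\<close> would make the
    root \<open>g i0\<close> equal to \<open>v - v = 0\<close>. The bound excludes the degenerate
    modulus 2, in which 1 and -1 coincide.\<close>
  have h1: "h \<noteq> 1"
  proof
    assume "h = 1"
    then have "C = id" using h(2) by simp
    then have "g i0 = 0"
      using B.gam_dual[OF assms(10)] xs C unfolding g_def by (metis cancel_comm_monoid_add_class.diff_cancel id_apply)
    then show False using gR[OF assms(10)] R0 by simp
  qed

  have \<Phi>: "bij_betw \<Phi> R (Ihat I p h)"
    and \<Phi>C: "\<And>b. b \<in> R \<Longrightarrow> \<Phi> (C b) = shift h 2 (\<Phi> b)"
    using assms(12) unfolding root_identification_def h_eq by simp_all
  have \<Phi>P: "\<forall>i\<in>I. fst (\<Phi> (beta R I \<alpha> C P i)) = i"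
    "\<forall>i j. arrow R I \<alpha> C P i j \<longrightarrow>
      \<Phi> (beta R I \<alpha> C P j) = (j, (snd (\<Phi> (beta R I \<alpha> C P i)) + 1) mod (2 * int h))"
    using assms(12) compat unfolding root_identification_def h_eq by blast+
  have \<Phi>fst: "fst (\<Phi> (g i)) = i" if "i \<in> I" for i
    using \<Phi>P(1) beta that by simp
  have \<Phi>arr: "\<Phi> (g j) = (j, (snd (\<Phi> (g i)) + 1) mod (2 * int h))" if "B.arr xs i j" for i j
  proof -
    have "i \<in> I" "j \<in> I" using that B.adj_in by (auto simp: B.arr_def)
    then show ?thesis using \<Phi>P(2) that beta unfolding arrow by metis
  qed
  \<comment> \<open>The levels of the \<beta> roots; they turn out to be a height function, and
    \<open>C\<close> moves its slice through all of \<open>Ihat\<close>.\<close>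
  define N where "N i = snd (\<Phi> (g i))" for i
  have \<Phi>g: "\<Phi> (g i) = (i, N i)" if "i \<in> I" for i
    using \<Phi>fst[OF that] by (simp add: N_def prod_eq_iff)
  have NI: "(i, N i) \<in> Ihat I p h" if "i \<in> I" for i
    using \<Phi>g[OF that] gR[OF that] \<Phi> by (metis bij_betwE)
  have Narr: "N j = (N i + 1) mod (2 * int h)" if "B.arr xs i j" for i j
    using \<Phi>arr[OF that] by (simp add: N_def)
  have \<Phi>k: "\<Phi> ((C ^^ k) (g i)) = (i, (N i + 2 * int k) mod (2 * int h))" if "i \<in> I" for i k
  proof (induction k)
    case 0
    then show ?case using \<Phi>g[OF that] NI[OF that] by (simp add: Ihat_def)
  next
    case (Suc k)
    have "\<Phi> ((C ^^ Suc k) (g i)) = shift h 2 (\<Phi> ((C ^^ k) (g i)))"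
      using \<Phi>C[OF CkR[OF gR[OF that]]] by simp
    also have "\<dots> = (i, (N i + 2 * int (Suc k)) mod (2 * int h))"
      unfolding Suc shift_def by (simp add: mod_simps algebra_simps)
    finally show ?case .
  qed
  define \<psi> where "\<psi> = inv_into R \<Phi>"
  have \<psi>\<Phi>: "\<psi> (\<Phi> b) = b" if "b \<in> R" for b
    unfolding \<psi>_def using \<Phi> that by (simp add: bij_betw_inv_into_left)
  have \<psi>_bij: "bij_betw \<psi> (Ihat I p h) R"
    unfolding \<psi>_def by (rule bij_betw_inv_into[OF \<Phi>])
  have \<psi>k: "\<psi> (i, (N i + 2 * int k) mod (2 * int h)) = (C ^^ k) (g i)" if "i \<in> I" for i k
    using \<psi>\<Phi>[OF CkR[OF gR[OF that]]] \<Phi>k[OF that] by metis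

  interpret M: mesh I E p h
    by standard (use B.finite_I h(1) B.adj_sym E assms(9) in auto)
  have lin: "linear (C ^^ k)" for k
  proof (induction k)
    case (Suc k)
    then show ?case
      unfolding funpow.simps by (intro linear_compose weyl_group_linear[OF CW])
  qed (simp add: id_def linear_ident)
  interpret V: mesh_vectors I E p h \<psi>
  proof
    fix i n assume n: "(i, n) \<in> Ihat I p h"
    let ?m = "2 * int h"
    have i: "i \<in> I" using n by (simp add: Ihat_def)
    have "even (n - N i)"
      using n NI[OF i] by (auto simp: Ihat_def cong_0_iff)
    \<comment> \<open>Every point of column \<open>i\<close> is a shift of \<open>(i, N i)\<close>,
      so its mesh relation is the image of \<open>cox_gam\<close> under
      \<open>C ^^ k\<close>.\<close>
    then obtain k where k: "(N i + 2 * int k) mod ?m = n"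
      using even_difference_mod[OF h(1)] n by (auto simp: Ihat_def)
    let ?out = "{j \<in> I. B.arr xs i j}" and ?in = "{j \<in> I. B.arr xs j i}"
    have nb: "{j \<in> I. E i j} = ?out \<union> ?in"
    proof -
      have "B.pos xs i \<noteq> B.pos xs j" if "B.adj i j" for j
        using that B.pos_inj[of i xs j] xs B.adj_in by metis
      then have "B.adj i j \<longleftrightarrow> B.arr xs i j \<or> B.arr xs j i" for j
        unfolding B.arr_def using B.adj_sym linorder_neqE_nat by metis
      then show ?thesis unfolding E by blast
    qed
    have "(\<Sum>j\<in>{j \<in> I. E i j}. \<psi> (j, (n + 1) mod ?m)) =
        (\<Sum>j\<in>?out. \<psi> (j, (n + 1) mod ?m)) + (\<Sum>j\<in>?in. \<psi> (j, (n + 1) mod ?m))"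
      unfolding nb
    proof (rule sum.union_disjoint)
      show "?out \<inter> ?in = {}" by (force simp: B.arr_def)
    qed (use B.finite_I in simp_all)
    also have "(\<Sum>j\<in>?out. \<psi> (j, (n + 1) mod ?m)) = (\<Sum>j\<in>?out. (C ^^ k) (g j))"
    proof (rule sum.cong[OF refl])
      fix j assume j: "j \<in> ?out"
      then have "(n + 1) mod ?m = (N j + 2 * int k) mod ?m"
        using Narr[of i j] unfolding k[symmetric] by (simp add: mod_simps algebra_simps)
      then show "\<psi> (j, (n + 1) mod ?m) = (C ^^ k) (g j)" using \<psi>k j by simp
    qed
    \<comment> \<open>A predecessor \<open>j\<close> satisfies \<open>N i + 1 = N j + 2\<close>
      modulo \<open>2 * h\<close>, so it needs one more application of \<open>C\<close> than a
      successor, for which \<open>N i + 1 = N j\<close>.\<close>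
    also have "(\<Sum>j\<in>?in. \<psi> (j, (n + 1) mod ?m)) = (\<Sum>j\<in>?in. (C ^^ k) (C (g j)))"
    proof (rule sum.cong[OF refl])
      fix j assume j: "j \<in> ?in"
      then have "(n + 1) mod ?m = (N j + 2 * int (Suc k)) mod ?m"
        using Narr[of j i] unfolding k[symmetric] by (simp add: mod_simps algebra_simps)
      then show "\<psi> (j, (n + 1) mod ?m) = (C ^^ k) (C (g j))"
        using \<psi>k[of j "Suc k"] j by (simp only: funpow_Suc_right comp_apply mem_Collect_eq)
    qed
    also have "(\<Sum>j\<in>?out. (C ^^ k) (g j)) + (\<Sum>j\<in>?in. (C ^^ k) (C (g j)))
        = (C ^^ k) (g i + C (g i))"
      using B.cox_gam[OF xs i] unfolding C[symmetric] g_def[symmetric]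
      by (simp add: linear_add[OF lin] linear_sum[OF lin])
    also have "\<dots> = (C ^^ k) (g i) + (C ^^ Suc k) (g i)"
      by (simp only: linear_add[OF lin] funpow_Suc_right comp_apply)
    also have "(C ^^ Suc k) (g i) = \<psi> (shift h 2 (i, n))"
    proof -
      have "(n + 2) mod ?m = (N i + 2 * int (Suc k)) mod ?m"
        unfolding k[symmetric] by (simp add: mod_simps algebra_simps)
      then show ?thesis using \<psi>k[OF i, of "Suc k"] by (simp add: shift_def del: funpow.simps)
    qed
    also have "(C ^^ k) (g i) = \<psi> (i, n)" using \<psi>k[OF i, of k] k by simp
    finally show "\<psi> (i, n) - (\<Sum>j\<in>{j \<in> I. E i j}. \<psi> (j, (n + 1) mod ?m)) + \<psi> (shift h 2 (i, n)) = 0"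
      by simp
  qed
  have sources: "M.has_sources \<eta>" for \<eta>
    unfolding M.has_sources_def
  proof (intro allI impI)
    fix A assume A: "A \<subseteq> I" "A \<noteq> {}"
    let ?D = "\<lambda>j i. E i j \<and> [\<eta> i = \<eta> j + 1] (mod (2 * int h))"
    \<comment> \<open>Both arrows at once would add up to a congruence forcing \<open>2 * h\<close>
      to divide 2, contrary to \<open>h1\<close>.\<close>
    have "\<not> ?D i j" if "?D j i" for i j
    proof
      assume "?D i j"
      then have "[\<eta> i + \<eta> j = \<eta> j + 1 + (\<eta> i + 1)] (mod (2 * int h))"
        using that by (intro cong_add) auto
      then have "2 * int h dvd 2 * 1" by (simp add: cong_iff_dvd_diff)
      then show False using h h1 by (simp only: dvd_mult_cancel_left) simp
    qed
    moreover have "B.adj j i" if "?D j i" for i j using that E B.adj_sym by blast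
    ultimately show "\<exists>i\<in>A. \<forall>j\<in>A. \<not> ?D j i"
      using B.orientation_has_source[OF A, of ?D] by blast
  qed
  have card_I: "card I = DIM('a)"
    using bij_betw_same_card[OF bij] dim_eq_card[of P UNIV] PR by (simp add: dim_UNIV)
  interpret Z: mesh_realization I E p h \<psi>
  proof
    fix \<eta> assume \<eta>: "height_function I E p h \<eta>"
    show "M.has_sources \<eta>" by (rule sources)
    fix d :: "'i \<Rightarrow> int" and i
    assume sum: "(\<Sum>i\<in>I. of_int (d i) *\<^sub>R \<psi> (i, \<eta> i)) = 0" and i: "i \<in> I"
    let ?f = "\<lambda>i. \<psi> (i, \<eta> i)"
    have "inj_on ?f I"
      using \<psi>_bij M.height_in_Ihat[OF \<eta>] by (auto simp: bij_betw_def inj_on_def)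
    \<comment> \<open>\<psi> maps \<open>Ihat\<close> onto \<open>R\<close>, so the slice vectors
      span the whole space; there are \<open>DIM('a)\<close> of them, hence they are
      independent.\<close>
    moreover have "R \<subseteq> span (?f ` I)"
      using V.slice_span_vectors[OF \<eta> sources] \<psi>_bij by (auto simp: bij_betw_def)
    then have "span (?f ` I) = UNIV"
      using spanR span_mono[of R "span (?f ` I)"] by (simp add: span_span top.extremum_unique)
    ultimately have "real_of_int (d i) = 0"
      using spanning_family_coeffs[of I ?f "\<lambda>i. of_int (d i)"] B.finite_I card_I sum i by simp
    then show "d i = 0" by simp
  next
    have "height_function I E p h N"
      unfolding height_function_def
    proof (intro conjI ballI impI)
      fix i assume i: "i \<in> I"
      show "N i \<in> {0..<2 * int h}" using NI[OF i] by (simp add: Ihat_def)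
      have "even (p i + N i)" using NI[OF i] by (simp add: Ihat_def cong_0_iff)
      then show "[N i = p i] (mod 2)" by (simp add: cong_iff_dvd_diff)
      fix j assume j: "j \<in> I" "E i j"
      have "B.pos xs i \<noteq> B.pos xs j"
        using B.pos_inj[of i xs j] xs i j E B.adj_in(3) by auto
      then have "B.arr xs i j \<or> B.arr xs j i"
        using j E B.adj_sym by (auto simp: B.arr_def)
      then show "[N j = N i + 1] (mod (2 * int h)) \<or> [N j = N i - 1] (mod (2 * int h))"
      proof
        assume "B.arr xs j i"
        from Narr[OF this] have "[N i = N j + 1] (mod (2 * int h))" by (simp add: cong_def)
        from cong_diff[OF this cong_refl[of 1]] show ?thesis by (simp add: cong_sym)
      qed (use Narr[of i j] in \<open>simp add: cong_def\<close>)
    qed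
    then show "\<exists>\<eta>. height_function I E p h \<eta>" by blast
  qed
  \<comment> \<open>Integer combinations of roots and values of \<open>ev\<close> are the same sums,
    reindexed along \<Phi> and its inverse \<psi>.\<close>
  have "carrier (root_lattice R) = V.ev ` carrier M.F"
  proof (intro equalityI subsetI)
    fix v assume "v \<in> carrier (root_lattice R)"
    then obtain c :: "'a \<Rightarrow> int" where v: "v = (\<Sum>a\<in>R. of_int (c a) *\<^sub>R a)"
      by (auto simp: root_lattice_def)
    let ?s = "\<Sum>x\<in>Ihat I p h. frag_cmul (c (\<psi> x)) (frag_of x)"
    have "V.ev ?s = (\<Sum>x\<in>Ihat I p h. of_int (c (\<psi> x)) *\<^sub>R \<psi> x)"
      by (simp add: V.ev_sum V.ev_cmul V.ev_frag_of cong: sum.cong)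
    also have "\<dots> = v"
      unfolding v by (rule sum.reindex_bij_betw[OF \<psi>_bij, of "\<lambda>a. of_int (c a) *\<^sub>R a"])
    finally have "v = V.ev ?s" ..
    moreover have "?s \<in> carrier M.F" by (intro sum_closed_free_Abelian_group) auto
    ultimately show "v \<in> V.ev ` carrier M.F" by blast
  next
    fix v assume "v \<in> V.ev ` carrier M.F"
    then obtain c where "v = V.ev c" by blast
    also have "V.ev c = (\<Sum>a\<in>R. of_int (Poly_Mapping.lookup c (\<Phi> a)) *\<^sub>R \<psi> (\<Phi> a))"
      unfolding V.ev_def by (rule sum.reindex_bij_betw[OF \<Phi>, symmetric])
    also have "\<dots> = (\<Sum>a\<in>R. of_int (Poly_Mapping.lookup c (\<Phi> a)) *\<^sub>R a)"
      by (rule sum.cong) (simp_all add: \<psi>\<Phi>)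
    finally show "v \<in> carrier (root_lattice R)" by (auto simp: root_lattice_def)
  qed
  from Z.lattice_iso[OF group_root_lattice _ this]
  obtain f where "f \<in> iso (root_lattice R) (mesh_lattice I E p h)"
    and f: "\<And>x. x \<in> Ihat I p h \<Longrightarrow> f (\<psi> x) = mesh_class I E p h x"
    by (auto simp: root_lattice_def)
  moreover have "f a = mesh_class I E p h (\<Phi> a)" if "a \<in> R" for a
    using f[of "\<Phi> a"] \<psi>\<Phi>[OF that] \<Phi> that by (metis bij_betwE)
  ultimately show ?thesis using Z.slice_basis by blast
qed

end
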